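(* Let $H$ be a graph with chromatic number $3$. Then, as $n\to\infty$ (with $H$ fixed), $RT(n,H,2\text{-mean}) \leq 0.4\,n^2(1+o(1))$. If moreover $H$ contains a triangle, then $RT(n,H,2\text{-mean}) = 0.4\,n^2(1+o(1))$.
   Context: All graphs are finite, undirected and simple. An edge coloring is an arbitrary assignment of colors to the edges (not necessarily proper, with no a priori bound on the total number of colors). A color is incident with a vertex $v$ if some edge containing $v$ has that color; an isolated vertex is incident with $0$ colors. For a real $\rho\ge 1$, an edge coloring of a graph with $n$ vertices is called $\rho$-mean if the average, over all $n$ vertices, of the number of distinct colors incident with the vertex is at most $\rho$. A monochromatic copy of $H$ is a (not necessarily induced) subgraph isomorphic to $H$ all of whose edges have the same color. $RT(n,H,\rho\text{-mean})$ is the maximum number of edges of a graph with $n$ vertices that admits a $\rho$-mean edge coloring with no monochromatic copy of $H$. *)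

theory Defs
  imports Complex_Main "HOL-Library.Landau_Symbols"
begin

type_synonym 'a ugraph = "'a set \<times> 'a set set"

abbreviation verts :: "'a ugraph \<Rightarrow> 'a set" where "verts G \<equiv> fst G"
abbreviation edges :: "'a ugraph \<Rightarrow> 'a set set" where "edges G \<equiv> snd G"

definition simple_graph :: "'a ugraph \<Rightarrow> bool" where
  "simple_graph G \<longleftrightarrow> finite (verts G) \<and> (\<forall>e\<in>edges G. e \<subseteq> verts G \<and> card e = 2)"

definition subgraph :: "'a ugraph \<Rightarrow> 'a ugraph \<Rightarrow> bool" where
  "subgraph S G \<longleftrightarrow> simple_graph S \<and> verts S \<subseteq> verts G \<and> edges S \<subseteq> edges G"

definition isomorphic :: "'a ugraph \<Rightarrow> 'b ugraph \<Rightarrow> bool" where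
  "isomorphic G H \<longleftrightarrow> (\<exists>f. bij_betw f (verts G) (verts H) \<and> edges H = (\<lambda>e. f ` e) ` edges G)"

definition proper_vertex_coloring :: "'a ugraph \<Rightarrow> nat \<Rightarrow> ('a \<Rightarrow> nat) \<Rightarrow> bool" where
  "proper_vertex_coloring G k f \<longleftrightarrow>
     f ` verts G \<subseteq> {..<k} \<and> (\<forall>x y. {x, y} \<in> edges G \<longrightarrow> f x \<noteq> f y)"

definition chromatic_number :: "'a ugraph \<Rightarrow> nat" where
  "chromatic_number G = (LEAST k. \<exists>f. proper_vertex_coloring G k f)"

definition contains_triangle :: "'a ugraph \<Rightarrow> bool" where
  "contains_triangle G \<longleftrightarrow>
     (\<exists>x y z. distinct [x, y, z] \<and> {x, y} \<in> edges G \<and> {y, z} \<in> edges G \<and> {x, z} \<in> edges G)"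

definition incident_colors :: "'a ugraph \<Rightarrow> ('a set \<Rightarrow> 'c) \<Rightarrow> 'a \<Rightarrow> 'c set" where
  "incident_colors G c v = c ` {e \<in> edges G. v \<in> e}"

definition mean_coloring :: "real \<Rightarrow> 'a ugraph \<Rightarrow> ('a set \<Rightarrow> 'c) \<Rightarrow> bool" where
  "mean_coloring \<rho> G c \<longleftrightarrow>
     (\<Sum>v\<in>verts G. real (card (incident_colors G c v))) / real (card (verts G)) \<le> \<rho>"

definition has_mono_copy :: "'a ugraph \<Rightarrow> ('a set \<Rightarrow> 'c) \<Rightarrow> 'b ugraph \<Rightarrow> bool" where
  "has_mono_copy G c H \<longleftrightarrow>
     (\<exists>S. subgraph S G \<and> isomorphic H S \<and> (\<exists>k. \<forall>e\<in>edges S. c e = k))"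

text \<open>Vertices and colors are natural numbers. Since the graphs are finite, this restricts neither
  the isomorphism type of \<open>G\<close> nor the number of colors.\<close>

definition RT_sizes :: "nat \<Rightarrow> 'a ugraph \<Rightarrow> real \<Rightarrow> nat set" where
  "RT_sizes n H \<rho> =
     {card (edges G) | G :: nat ugraph. simple_graph G \<and> card (verts G) = n \<and>
        (\<exists>c :: nat set \<Rightarrow> nat. mean_coloring \<rho> G c \<and> \<not> has_mono_copy G c H)}"

definition RT_mean :: "nat \<Rightarrow> 'a ugraph \<Rightarrow> real \<Rightarrow> nat" where
  "RT_mean n H \<rho> = Max (RT_sizes n H \<rho>)"

text \<open>The maximum is over a finite nonempty set whenever \<open>H\<close> has an edge.\<close>

lemma finite_RT_sizes: "finite (RT_sizes n H \<rho>)"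
proof (rule finite_subset)
  show "RT_sizes n H \<rho> \<subseteq> {..2 ^ n}"
  proof
    fix m assume "m \<in> RT_sizes n H \<rho>"
    then obtain G :: "nat ugraph" where G: "simple_graph G" "card (verts G) = n" "m = card (edges G)"
      unfolding RT_sizes_def by blast
    then have "finite (verts G)" "edges G \<subseteq> Pow (verts G)"
      unfolding simple_graph_def by auto
    then have "card (edges G) \<le> card (Pow (verts G))"
      by (intro card_mono) auto
    with G \<open>finite (verts G)\<close> show "m \<in> {..2 ^ n}"
      by (simp add: card_Pow)
  qed
qed simp

lemma RT_sizes_nonempty:
  assumes "edges H \<noteq> {}" "\<rho> \<ge> 0"
  shows "RT_sizes n H \<rho> \<noteq> {}"
proof -
  let ?G = "({..<n}, {}) :: nat ugraph"
  have "\<not> has_mono_copy ?G (\<lambda>_. 0 :: nat) H"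
    using assms(1) unfolding has_mono_copy_def subgraph_def isomorphic_def by auto
  moreover have "mean_coloring \<rho> ?G (\<lambda>_. 0 :: nat)"
    using assms(2) unfolding mean_coloring_def incident_colors_def by simp
  moreover have "simple_graph ?G" "card (verts ?G) = n"
    unfolding simple_graph_def by auto
  ultimately have "card (edges ?G) \<in> RT_sizes n H \<rho>"
    unfolding RT_sizes_def by blast
  then show ?thesis by blast
qed

end

theory Submission
  imports Defs "HOL-Library.FuncSet"
begin

text \<open>The value $0.4$ is the edge density of a balanced complete $5$-partite graph: $K_5$ is the union of
two edge-disjoint $5$-cycles, so it can be coloured with two colours and without a monochromatic
triangle. Blowing up its vertices gives the lower bound when \<open>H\<close> contains a triangle.

For the upper bound, first consider complete graphs without a monochromatic triangle. If every vertex
sees at most \<open>k\<close> colours, the order is at most $g(k)$, where $g(0) = 1$ and $g(k+1) = (k+1)\,g(k) + 1$, hence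
$g = 1, 2, 5, 16, 65, \dots$. This holds in the weighted form $\sum_v 1/g(c_v) \le 1$, where $c_v$ is the
number of colours at \<open>v\<close> (lemma \<open>clique_local_ramsey_sum\<close>). Put $b_v = \max(0, 4 - c_v)$. Since
$b^2 \le 20/g(4-b)$ for $b = 0, \dots, 4$, the sum of the $b_v^2$ is at most $20$, and completing squares
gives, for all real vertex weights $x$ of sum $1$,
\[ \sum_{u \ne v} x_u x_v + \tfrac15 \sum_v x_v b_v
   = 1 + \tfrac1{100} \sum_v b_v^2 - \sum_v \Bigl(x_v - \frac{b_v}{10}\Bigr)^2 \le \tfrac65 . \]
The argument of Motzkin and Straus (move the weight of one of two nonadjacent vertices to the other)
extends the bound, for nonnegative weights, to every graph without a monochromatic triangle
(lemma \<open>lagrangian_le\<close>). With uniform weights on \<open>n\<close> vertices and a mean of at most two colours, the bonus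
term is at least $\frac25$, so that $2e/n^2 \le \frac65 - \frac25 = \frac45$. That the penalty for
additional colours is linear is what makes the average number of colours sufficient.

It remains to pass from triangles to \<open>H\<close>. The bound is applied to random samples of boundedly many
vertices: a sample sees no more colours than the whole graph, so a density above $\frac45$
forces monochromatic triangles in a positive fraction of the samples and thus $\delta n^3$ monochromatic triangles
in total (theorem \<open>mono_triangle_supersaturation\<close>). The number of colours is unbounded, but the sets of vertices incident
with the colours have total size at most $2n$; hence a single colour carries a positive fraction of all triples
(lemma \<open>dominant_colour\<close>). Two rounds of the Kovari-Sos-Turan argument then produce a complete
tripartite graph with large parts in this colour, and it contains every $3$-colourable \<open>H\<close>.\<close>

section \<open>Partial edge colourings and monochromatic triangles\<close>

text \<open>A coloured graph is encoded by one function on pairs of vertices, with the value \<open>None\<close> for non-edges.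
Induced subgraphs then need no notation, and blow-ups are obtained by composition with a map between
vertex sets.\<close>

definition edge_colouring :: "('i \<Rightarrow> 'i \<Rightarrow> 'c option) \<Rightarrow> bool" where
  "edge_colouring K \<longleftrightarrow> (\<forall>i j. K i j = K j i) \<and> (\<forall>i. K i i = None)"

definition palette :: "('i \<Rightarrow> 'i \<Rightarrow> 'c option) \<Rightarrow> 'i set \<Rightarrow> 'i \<Rightarrow> 'c set" where
  "palette K V v = {a. \<exists>u\<in>V. K v u = Some a}"

definition mono_triangle :: "('i \<Rightarrow> 'i \<Rightarrow> 'c option) \<Rightarrow> 'c \<Rightarrow> 'i \<Rightarrow> 'i \<Rightarrow> 'i \<Rightarrow> bool" where
  "mono_triangle K a i j k \<longleftrightarrow> K i j = Some a \<and> K j k = Some a \<and> K i k = Some a"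

definition mono_triangle_free :: "('i \<Rightarrow> 'i \<Rightarrow> 'c option) \<Rightarrow> 'i set \<Rightarrow> bool" where
  "mono_triangle_free K V \<longleftrightarrow> (\<forall>i\<in>V. \<forall>j\<in>V. \<forall>k\<in>V. \<forall>a. \<not> mono_triangle K a i j k)"

lemma palette_mono: "U \<subseteq> V \<Longrightarrow> palette K U v \<subseteq> palette K V v"
  unfolding palette_def by blast

lemma finite_palette: "finite V \<Longrightarrow> finite (palette K V v)"
proof (rule finite_subset)
  show "palette K V v \<subseteq> (\<lambda>u. the (K v u)) ` V"
    unfolding palette_def by force
qed simp

lemma card_palette_mono: "U \<subseteq> V \<Longrightarrow> finite V \<Longrightarrow> card (palette K U v) \<le> card (palette K V v)"
  by (intro card_mono finite_palette palette_mono)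

lemma mono_triangle_free_subset:
  "mono_triangle_free K V \<Longrightarrow> U \<subseteq> V \<Longrightarrow> mono_triangle_free K U"
  unfolding mono_triangle_free_def by blast

section \<open>Cliques without a monochromatic triangle\<close>

text \<open>An upper bound for the order of a clique without a monochromatic triangle in which every vertex sees at most
\<open>k\<close> colours: the neighbours of a vertex in one colour do not see that colour among themselves. In closed form
it is $\lfloor e\,k!\rfloor$ for $k \ge 1$.\<close>

fun local_ramsey :: "nat \<Rightarrow> nat" where
  "local_ramsey 0 = 1"
| "local_ramsey (Suc k) = Suc k * local_ramsey k + 1"

lemma local_ramsey_pos: "local_ramsey k > 0"
  by (cases k) auto

lemma local_ramsey_mono: "k \<le> l \<Longrightarrow> local_ramsey k \<le> local_ramsey l"
proof (induction rule: dec_induct)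
  case (step l)
  have "local_ramsey l \<le> local_ramsey (Suc l)" by simp
  with step show ?case by linarith
qed simp

text \<open>The ratio $g(c)/g(c-1) = c + 1/g(c-1)$ is increasing in $c$. In the next proof this makes the vertex with
the fewest colours the right one to remove.\<close>

lemma local_ramsey_log_convex:
  assumes "k \<le> c"
  shows "local_ramsey c * local_ramsey (Suc k) \<le> local_ramsey (Suc c) * local_ramsey k"
proof (cases "k = c")
  case False
  let ?g = local_ramsey
  from False assms have "Suc k \<le> c" by simp
  then have "Suc k * (?g c * ?g k) \<le> c * (?g c * ?g k)"
    by (rule mult_right_mono) simp
  moreover have "?g c \<le> ?g c * ?g k"
    using local_ramsey_pos[of k] by simp
  moreover have "?g c * ?g (Suc k) = Suc k * (?g c * ?g k) + ?g c"
    and "?g (Suc c) * ?g k = c * (?g c * ?g k) + ?g c * ?g k + ?g k"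
    by (simp_all add: algebra_simps)
  ultimately show ?thesis by linarith
qed simp

text \<open>Induction on the clique: let \<open>v\<close> see the smallest number \<open>k\<close> of colours. A neighbour \<open>u\<close> in colour \<open>a\<close> loses
the colour \<open>a\<close> when the graph is restricted to the \<open>a\<close>-neighbours of \<open>v\<close>, so its weight grows at least by the
factor $g(c_u)/g(c_u-1) \ge g(k)/g(k-1)$. By induction each of the \<open>k\<close> neighbourhoods contributes at most
$g(k-1)/g(k)$, and the total is $(1 + k\,g(k-1))/g(k) = 1$.\<close>

lemma clique_local_ramsey_sum:
  assumes "finite V" "edge_colouring K" "mono_triangle_free K V"
    and "\<And>i j. i \<in> V \<Longrightarrow> j \<in> V \<Longrightarrow> i \<noteq> j \<Longrightarrow> K i j \<noteq> None"
  shows "(\<Sum>i\<in>V. 1 / real (local_ramsey (card (palette K V i)))) \<le> 1"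
  using assms
proof (induction "card V" arbitrary: V rule: less_induct)
  case less
  let ?g = "\<lambda>k. real (local_ramsey k)"
  let ?d = "\<lambda>i. card (palette K V i)"
  have sym: "\<And>i j. K i j = K j i" and irr: "\<And>i. K i i = None"
    using less.prems(2) by (auto simp: edge_colouring_def)
  have gpos: "?g k > 0" for k using local_ramsey_pos by simp
  show ?case
  proof (cases "V = {}")
    case False
    obtain v where v: "v \<in> V" and vmin: "\<And>u. u \<in> V \<Longrightarrow> ?d v \<le> ?d u"
      using arg_min_if_finite(1)[OF less.prems(1) False, of ?d]
        arg_min_least[OF less.prems(1) False, of _ ?d] by blast
    define N where "N a = {u\<in>V. K v u = Some a}" for a
    have split: "V = insert v (\<Union>a\<in>palette K V v. N a)"
    proof
      show "V \<subseteq> insert v (\<Union>a\<in>palette K V v. N a)"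
      proof
        fix u assume u: "u \<in> V"
        show "u \<in> insert v (\<Union>a\<in>palette K V v. N a)"
        proof (cases "u = v")
          case False
          then obtain a where "K v u = Some a" using less.prems(4)[OF v u] by auto
          then show ?thesis using u by (auto simp: N_def palette_def)
        qed simp
      qed
    qed (use v in \<open>auto simp: N_def\<close>)
    have finN: "finite (N a)" for a using less.prems(1) by (simp add: N_def)
    have finU: "finite (\<Union>a\<in>palette K V v. N a)"
      using finN finite_palette[OF less.prems(1)] by blast
    have vN: "v \<notin> N a" for a using irr by (simp add: N_def)
    have "(\<Sum>i\<in>V. 1 / ?g (?d i)) =
        1 / ?g (?d v) + (\<Sum>i\<in>(\<Union>a\<in>palette K V v. N a). 1 / ?g (?d i))"
      by (subst split, subst sum.insert) (use vN finU in auto)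
    also have "(\<Sum>i\<in>(\<Union>a\<in>palette K V v. N a). 1 / ?g (?d i)) =
        (\<Sum>a\<in>palette K V v. \<Sum>i\<in>N a. 1 / ?g (?d i))"
      by (rule sum.UNION_disjoint)
        (use finN finite_palette[OF less.prems(1)] in \<open>auto simp: N_def\<close>)
    also have "\<dots> \<le> (\<Sum>a\<in>palette K V v. ?g (?d v - 1) / ?g (?d v))"
    proof (rule sum_mono)
      fix a assume a: "a \<in> palette K V v"
      have kpos: "?d v > 0"
        using a finite_palette[OF less.prems(1)] by (auto simp: card_gt_0_iff)
      have NV: "N a \<subseteq> V" by (auto simp: N_def)
      have IH: "(\<Sum>i\<in>N a. 1 / ?g (card (palette K (N a) i))) \<le> 1"
      proof (rule less.hyps)
        show "card (N a) < card V"
          by (rule psubset_card_mono) (use less.prems(1) NV v vN in auto)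
        show "mono_triangle_free K (N a)"
          using less.prems(3) NV mono_triangle_free_subset by blast
        show "K i j \<noteq> None" if "i \<in> N a" "j \<in> N a" "i \<noteq> j" for i j
          using that NV less.prems(4) by blast
      qed (use finN less.prems(2) in auto)
      have "1 / ?g (?d i) \<le> (?g (?d v - 1) / ?g (?d v)) * (1 / ?g (card (palette K (N a) i)))"
        if i: "i \<in> N a" for i
      proof -
        have iV: "i \<in> V" and ci: "K v i = Some a" using i by (auto simp: N_def)
        have "palette K (N a) i \<subseteq> palette K V i - {a}"
        proof
          fix b assume "b \<in> palette K (N a) i"
          then obtain u where u: "u \<in> V" "K v u = Some a" "K i u = Some b"
            by (auto simp: palette_def N_def)
          have "\<not> mono_triangle K a v i u"
            using less.prems(3) v iV u by (auto simp: mono_triangle_free_def)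
          then show "b \<in> palette K V i - {a}"
            using u ci by (auto simp: palette_def mono_triangle_def)
        qed
        then have "card (palette K (N a) i) \<le> card (palette K V i - {a})"
          by (intro card_mono) (use finite_palette[OF less.prems(1)] in auto)
        also have "\<dots> = ?d i - 1"
        proof -
          have "a \<in> palette K V i" using v ci sym by (auto simp: palette_def)
          then show ?thesis by simp
        qed
        finally have 1: "1 / ?g (?d i - 1) \<le> 1 / ?g (card (palette K (N a) i))"
          using local_ramsey_mono gpos by (intro divide_left_mono) (auto simp: local_ramsey_pos)
        have le: "?d v \<le> ?d i" by (rule vmin[OF iV])
        have "local_ramsey (?d i - 1) * local_ramsey (?d v) \<le> local_ramsey (?d i) * local_ramsey (?d v - 1)"
          using local_ramsey_log_convex[of "?d v - 1" "?d i - 1"] le kpos by simp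
        then have "?g (?d i - 1) * ?g (?d v) \<le> ?g (?d i) * ?g (?d v - 1)"
          by (metis of_nat_le_iff of_nat_mult)
        then have "1 / ?g (?d i) \<le> (?g (?d v - 1) / ?g (?d v)) * (1 / ?g (?d i - 1))"
          using gpos by (simp add: field_simps local_ramsey_pos)
        also have "\<dots> \<le> (?g (?d v - 1) / ?g (?d v)) * (1 / ?g (card (palette K (N a) i)))"
          by (intro mult_left_mono 1) simp
        finally show ?thesis .
      qed
      then have "(\<Sum>i\<in>N a. 1 / ?g (?d i)) \<le>
          (?g (?d v - 1) / ?g (?d v)) * (\<Sum>i\<in>N a. 1 / ?g (card (palette K (N a) i)))"
        unfolding sum_distrib_left by (rule sum_mono)
      also have "\<dots> \<le> (?g (?d v - 1) / ?g (?d v)) * 1"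
        by (intro mult_left_mono IH) simp
      finally show "(\<Sum>i\<in>N a. 1 / ?g (?d i)) \<le> ?g (?d v - 1) / ?g (?d v)" by simp
    qed
    also have "1 / ?g (?d v) + (\<Sum>a\<in>palette K V v. ?g (?d v - 1) / ?g (?d v)) = 1"
    proof (cases "?d v")
      case (Suc k)
      then show ?thesis using gpos[of "Suc k"] by (simp add: field_simps)
    qed simp
    finally show ?thesis by simp
  qed simp
qed

section \<open>A weighted Turan inequality with a penalty for colours\<close>

text \<open>The slope one, together with the factor $\frac15$ used below, is a supporting line at two colours of the extremal
density as a function of the mean number of colours. Truncation at $0$ keeps \<open>bonus_square_le\<close> true beyond four
colours.\<close>

definition bonus :: "nat \<Rightarrow> real" where
  "bonus d = max 0 (4 - real d)"

lemma bonus_nonneg: "0 \<le> bonus d" and bonus_le: "bonus d \<le> 4" and bonus_ge: "4 - real d \<le> bonus d"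
  by (auto simp: bonus_def)

lemma bonus_antimono: "d \<le> e \<Longrightarrow> bonus e \<le> bonus d"
  by (auto simp: bonus_def)

lemma bonus_square_le: "(bonus d)\<^sup>2 \<le> 20 / real (local_ramsey d)"
proof -
  consider "d = 0" | "d = 1" | "d = 2" | "d = 3" | "d \<ge> 4" by linarith
  then show ?thesis
    by cases (auto simp: bonus_def numeral_eq_Suc)
qed

text \<open>The Motzkin-Straus form, summed over ordered pairs, with a linear reward for the vertices.\<close>

definition lagrangian :: "('i \<Rightarrow> 'i \<Rightarrow> 'c option) \<Rightarrow> ('i \<Rightarrow> real) \<Rightarrow> 'i set \<Rightarrow> ('i \<Rightarrow> real) \<Rightarrow> real" where
  "lagrangian K \<beta> V x =
     (\<Sum>i\<in>V. \<Sum>j\<in>V. of_bool (K i j \<noteq> None) * x i * x j) + (\<Sum>i\<in>V. x i * \<beta> i)"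

lemma lagrangian_insert:
  assumes "finite R" "u \<notin> R" "edge_colouring K"
  shows "lagrangian K \<beta> (insert u R) x =
     lagrangian K \<beta> R x + x u * (2 * (\<Sum>j\<in>R. of_bool (K u j \<noteq> None) * x j) + \<beta> u)"
proof -
  have comm: "K i u = K u i" and irr: "K u u = None" for i
    using assms(3) by (auto simp: edge_colouring_def)
  let ?D = "\<Sum>j\<in>R. of_bool (K u j \<noteq> None) * x j"
  have row: "(\<Sum>j\<in>R. of_bool (K u j \<noteq> None) * x u * x j) = x u * ?D"
    unfolding sum_distrib_left by (intro sum.cong) auto
  have column: "(\<Sum>i\<in>R. of_bool (K i u \<noteq> None) * x i * x u) = x u * ?D"
    unfolding sum_distrib_left comm by (intro sum.cong) auto
  have "(\<Sum>i\<in>insert u R. \<Sum>j\<in>insert u R. of_bool (K i j \<noteq> None) * x i * x j) =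
      x u * ?D + (x u * ?D + (\<Sum>i\<in>R. \<Sum>j\<in>R. of_bool (K i j \<noteq> None) * x i * x j))"
    by (simp only: sum.insert[OF assms(1,2)] sum.distrib row column) (simp add: irr)
  then show ?thesis
    using assms(1,2) by (simp add: lagrangian_def distrib_left)
qed

text \<open>Along the direction that moves weight between two nonadjacent vertices the form is affine, because it has no
term in $x_u^2$, $x_v^2$ or $x_u x_v$. Moving all the weight of \<open>u\<close> to a vertex with at least the same partial derivative does
not decrease it.\<close>

lemma lagrangian_shift:
  assumes "finite V" "edge_colouring K" "u \<in> V" "v \<in> V" "u \<noteq> v" "K u v = None" "x u \<ge> 0"
    and le: "2 * (\<Sum>j\<in>V-{u,v}. of_bool (K u j \<noteq> None) * x j) + \<beta> u
           \<le> 2 * (\<Sum>j\<in>V-{u,v}. of_bool (K v j \<noteq> None) * x j) + \<beta> v"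
  shows "lagrangian K \<beta> V x \<le> lagrangian K \<beta> (V - {u}) (x(v := x u + x v))"
proof -
  define R where "R = V - {u,v}"
  have R: "finite R" "u \<notin> R" "v \<notin> R" and V: "V = insert u (insert v R)" and Vu: "V - {u} = insert v R"
    using assms(1,3,4,5) by (auto simp: R_def)
  let ?x = "x(v := x u + x v)"
  let ?D = "\<lambda>w. 2 * (\<Sum>j\<in>R. of_bool (K w j \<noteq> None) * x j) + \<beta> w"
  have "lagrangian K \<beta> V x = lagrangian K \<beta> R x + x v * ?D v + x u * ?D u"
    unfolding V using R assms(2,5,6) by (subst lagrangian_insert; simp add: lagrangian_insert)
  also have "\<dots> \<le> lagrangian K \<beta> R x + x v * ?D v + x u * ?D v"
    using mult_left_mono[OF le assms(7)] by (simp add: R_def)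
  also have "\<dots> = lagrangian K \<beta> R ?x + ?x v * (2 * (\<Sum>j\<in>R. of_bool (K v j \<noteq> None) * ?x j) + \<beta> v)"
  proof -
    have "(\<Sum>j\<in>R. of_bool (K v j \<noteq> None) * ?x j) = (\<Sum>j\<in>R. of_bool (K v j \<noteq> None) * x j)"
      using R by (intro sum.cong) auto
    moreover have "lagrangian K \<beta> R ?x = lagrangian K \<beta> R x"
      unfolding lagrangian_def using R by (intro arg_cong2[where f="(+)"] sum.cong) auto
    ultimately show ?thesis by (simp add: algebra_simps)
  qed
  also have "\<dots> = lagrangian K \<beta> (V - {u}) ?x"
    unfolding Vu using R assms(2) by (subst lagrangian_insert) auto
  finally show ?thesis .
qed

text \<open>On a clique the quadratic part is $1 - \sum_i x_i^2$, and the squares can be completed; the summand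
$x_i b_i/5 - x_i^2$ is largest at $x_i = b_i/10$, where it equals $b_i^2/100$.\<close>

lemma lagrangian_clique_le:
  assumes "finite V" "edge_colouring K" "mono_triangle_free K V"
    and clique: "\<And>i j. i \<in> V \<Longrightarrow> j \<in> V \<Longrightarrow> i \<noteq> j \<Longrightarrow> K i j \<noteq> None"
    and "(\<Sum>i\<in>V. x i) = 1"
  shows "lagrangian K (\<lambda>i. bonus (card (palette K V i)) / 5) V x \<le> 6 / 5"
proof -
  let ?b = "\<lambda>i. bonus (card (palette K V i))"
  have irr: "K i i = None" for i using assms(2) by (auto simp: edge_colouring_def)
  have "(\<Sum>i\<in>V. \<Sum>j\<in>V. of_bool (K i j \<noteq> None) * x i * x j) = (\<Sum>i\<in>V. x i * (1 - x i))"
  proof (rule sum.cong[OF refl])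
    fix i assume i: "i \<in> V"
    have "(\<Sum>j\<in>V. of_bool (K i j \<noteq> None) * x i * x j) = (\<Sum>j\<in>V-{i}. x i * x j)"
    proof (subst sum.remove[OF assms(1) i])
      have "K i j \<noteq> None" if "j \<in> V - {i}" for j
        using clique[OF i] that by blast
      then show "of_bool (K i i \<noteq> None) * x i * x i +
          (\<Sum>j\<in>V-{i}. of_bool (K i j \<noteq> None) * x i * x j) = (\<Sum>j\<in>V-{i}. x i * x j)"
        by (simp add: irr)
    qed
    also have "\<dots> = x i * (1 - x i)"
      using assms(5) sum.remove[OF assms(1) i, of x] by (simp flip: sum_distrib_left)
    finally show "(\<Sum>j\<in>V. of_bool (K i j \<noteq> None) * x i * x j) = x i * (1 - x i)" .
  qed
  then have "lagrangian K (\<lambda>i. ?b i / 5) V x = (\<Sum>i\<in>V. x i + (x i * ?b i / 5 - (x i)\<^sup>2))"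
    unfolding lagrangian_def by (simp flip: sum.distrib add: algebra_simps power2_eq_square)
  also have "\<dots> \<le> (\<Sum>i\<in>V. x i + (1 / 5) * (1 / real (local_ramsey (card (palette K V i)))))"
  proof (rule sum_mono)
    fix i
    have "0 \<le> (x i - ?b i / 10)\<^sup>2" by simp
    then have "x i * ?b i / 5 - (x i)\<^sup>2 \<le> (?b i)\<^sup>2 / 100"
      by (simp add: power2_diff power_divide algebra_simps)
    also have "\<dots> \<le> (1 / 5) * (1 / real (local_ramsey (card (palette K V i))))"
      using bonus_square_le[of "card (palette K V i)"] by simp
    finally show "x i + (x i * ?b i / 5 - (x i)\<^sup>2) \<le>
      x i + (1 / 5) * (1 / real (local_ramsey (card (palette K V i))))" by simp
  qed
  also have "\<dots> = 1 + (1 / 5) * (\<Sum>i\<in>V. 1 / real (local_ramsey (card (palette K V i))))"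
    by (simp only: sum.distrib assms(5) sum_distrib_left)
  also have "\<dots> \<le> 6 / 5"
    using clique_local_ramsey_sum[OF assms(1-3) clique] by simp
  finally show ?thesis .
qed

text \<open>Deleting vertices only shrinks palettes and so never decreases the bonus, so the shift of weights can be
iterated until the support is a clique.\<close>

lemma lagrangian_le:
  assumes "finite V" "edge_colouring K" "mono_triangle_free K V"
    and "\<And>i. i \<in> V \<Longrightarrow> x i \<ge> 0" "(\<Sum>i\<in>V. x i) = 1"
  shows "lagrangian K (\<lambda>i. bonus (card (palette K V i)) / 5) V x \<le> 6 / 5"
  using assms
proof (induction "card V" arbitrary: V x rule: less_induct)
  case less
  let ?\<beta> = "\<lambda>V i. bonus (card (palette K V i)) / 5"
  have sym: "\<And>i j. K i j = K j i"
    using less.prems(2) by (auto simp: edge_colouring_def)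
  let ?D = "\<lambda>w u v. 2 * (\<Sum>j\<in>V-{u,v}. of_bool (K w j \<noteq> None) * x j) + ?\<beta> V w"
  show ?case
  proof (cases "\<exists>u\<in>V. \<exists>v\<in>V. u \<noteq> v \<and> K u v = None")
    case False
    then have clique: "K i j \<noteq> None" if "i \<in> V" "j \<in> V" "i \<noteq> j" for i j
      using that by auto
    show ?thesis
      by (rule lagrangian_clique_le[OF less.prems(1-3) clique less.prems(5)])
  next
    case True
    then obtain u v where uv: "u \<in> V" "v \<in> V" "u \<noteq> v" "K u v = None" "?D u u v \<le> ?D v u v"
    proof -
      obtain u v where uv: "u \<in> V" "v \<in> V" "u \<noteq> v" "K u v = None" using True by blast
      show thesis
      proof (cases "?D u u v \<le> ?D v u v")
        case False
        then have "?D v v u \<le> ?D u v u" unfolding insert_commute[of v u] by linarith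
        moreover have "K v u = None" using uv(4) sym[of v u] by simp
        ultimately show ?thesis using that[of v u] uv(1-3) by blast
      qed (use that uv in blast)
    qed
    let ?x = "x(v := x u + x v)"
    have "lagrangian K (?\<beta> V) V x \<le> lagrangian K (?\<beta> V) (V - {u}) ?x"
      by (rule lagrangian_shift[OF less.prems(1,2) uv(1-4) _ uv(5)]) (rule less.prems(4)[OF uv(1)])
    also have "\<dots> \<le> lagrangian K (?\<beta> (V - {u})) (V - {u}) ?x"
      unfolding lagrangian_def
    proof (intro add_left_mono sum_mono mult_left_mono divide_right_mono bonus_antimono card_palette_mono)
      fix i assume "i \<in> V - {u}"
      then show "0 \<le> ?x i" using less.prems(4) uv by auto
    qed (use less.prems in auto)
    also have "\<dots> \<le> 6 / 5"
    proof (rule less.hyps)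
      show "card (V - {u}) < card V" using less.prems(1) uv by (meson card_Diff1_less)
      show "mono_triangle_free K (V - {u})"
        using mono_triangle_free_subset[OF less.prems(3)] by blast
      have "sum x V = x u + (x v + sum x (V - {u} - {v}))"
        using less.prems(1) uv by (subst sum.remove[of _ u], simp, simp, subst sum.remove[of _ v]) auto
      moreover have "sum ?x (V - {u}) = ?x v + sum x (V - {u} - {v})"
        using less.prems(1) uv by (subst sum.remove[of _ v]) (auto intro!: sum.cong)
      ultimately show "sum ?x (V - {u}) = 1" using less.prems(5) by simp
    qed (use less.prems uv in auto)
    finally show ?thesis .
  qed
qed

section \<open>Supersaturation by sampling\<close>

lemma sum_PiE_fun_upd:
  fixes F :: "('i \<Rightarrow> 'v) \<Rightarrow> real"
  assumes "i \<in> I"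
  shows "(\<Sum>s\<in>I \<rightarrow>\<^sub>E V. F s) = (\<Sum>x\<in>V. \<Sum>s\<in>(I - {i}) \<rightarrow>\<^sub>E V. F (s(i := x)))"
proof -
  have "I \<rightarrow>\<^sub>E V = (\<lambda>(x, s). s(i := x)) ` (V \<times> ((I - {i}) \<rightarrow>\<^sub>E V))"
    using PiE_insert_eq[of i "I - {i}" "\<lambda>_. V"] assms by (simp add: insert_absorb)
  moreover have "inj_on (\<lambda>(x, s). s(i := x)) (V \<times> ((I - {i}) \<rightarrow>\<^sub>E V))"
    by (rule inj_combinator) simp
  ultimately show ?thesis
    by (simp add: sum.reindex sum.cartesian_product case_prod_unfold)
qed

lemma sum_PiE_one_coordinate:
  fixes f :: "'v \<Rightarrow> real"
  assumes "finite I" "i \<in> I"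
  shows "(\<Sum>s\<in>I \<rightarrow>\<^sub>E V. f (s i)) = real (card V) ^ (card I - 1) * (\<Sum>x\<in>V. f x)"
  using assms by (simp add: sum_PiE_fun_upd[OF assms(2)] card_PiE sum_distrib_left)

lemma sum_PiE_two_coordinates:
  fixes f :: "'v \<Rightarrow> 'v \<Rightarrow> real"
  assumes "finite I" "i \<in> I" "j \<in> I" "i \<noteq> j"
  shows "(\<Sum>s\<in>I \<rightarrow>\<^sub>E V. f (s i) (s j)) =
     real (card V) ^ (card I - 2) * (\<Sum>x\<in>V. \<Sum>y\<in>V. f x y)"
  using assms
  by (simp add: sum_PiE_fun_upd[OF assms(2)] sum_PiE_one_coordinate sum_distrib_left eval_nat_numeral)

lemma sum_PiE_three_coordinates:
  fixes f :: "'v \<Rightarrow> 'v \<Rightarrow> 'v \<Rightarrow> real"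
  assumes "finite I" "i \<in> I" "j \<in> I" "k \<in> I" "i \<noteq> j" "i \<noteq> k" "j \<noteq> k"
  shows "(\<Sum>s\<in>I \<rightarrow>\<^sub>E V. f (s i) (s j) (s k)) =
     real (card V) ^ (card I - 3) * (\<Sum>x\<in>V. \<Sum>y\<in>V. \<Sum>z\<in>V. f x y z)"
  using assms
  by (simp add: sum_PiE_fun_upd[OF assms(2)] sum_PiE_two_coordinates sum_distrib_left eval_nat_numeral)

definition mono_triangles :: "('i \<Rightarrow> 'i \<Rightarrow> 'c option) \<Rightarrow> 'i set \<Rightarrow> ('i \<times> 'i \<times> 'i) set" where
  "mono_triangles K V = {(x, y, z). x \<in> V \<and> y \<in> V \<and> z \<in> V \<and> (\<exists>a. mono_triangle K a x y z)}"

text \<open>A sample \<open>s\<close>, possibly with repetitions, carries the pulled-back colouring of its index set; this is a blow-up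
of an induced subgraph, so that no multiplicities have to be tracked. If it has no monochromatic triangle,
\<open>lagrangian_le\<close> applies with uniform weights. Otherwise the last sum is at least $1$, which
covers the trivial bound $1 + \frac45$.\<close>

lemma sample_lagrangian_le:
  assumes "finite V" "edge_colouring K" "s \<in> I \<rightarrow>\<^sub>E V" "finite I" "I \<noteq> {}"
  shows "lagrangian (\<lambda>i j. K (s i) (s j)) (\<lambda>i. bonus (card (palette K V (s i))) / 5) I
           (\<lambda>_. 1 / real (card I))
         \<le> 6 / 5 + (\<Sum>(i, j, k)\<in>I\<times>I\<times>I. of_bool ((s i, s j, s k) \<in> mono_triangles K V))"
    (is "lagrangian ?K ?\<beta> I ?x \<le> _ + ?T")
proof -
  have sV: "s i \<in> V" if "i \<in> I" for i using assms(3) that by auto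
  have m: "real (card I) > 0" using assms(4,5) by (simp add: card_gt_0_iff)
  have x: "(\<Sum>i\<in>I. ?x i) = 1" using m by simp
  have T: "?T \<ge> 0" by (intro sum_nonneg) auto
  show ?thesis
  proof (cases "mono_triangle_free ?K I")
    case True
    have "lagrangian ?K ?\<beta> I ?x \<le> lagrangian ?K (\<lambda>i. bonus (card (palette ?K I i)) / 5) I ?x"
      unfolding lagrangian_def
    proof (intro add_left_mono sum_mono mult_left_mono divide_right_mono bonus_antimono)
      fix i assume "i \<in> I"
      show "card (palette ?K I i) \<le> card (palette K V (s i))"
        using sV by (intro card_mono finite_palette assms) (auto simp: palette_def)
    qed auto
    also have "\<dots> \<le> 6 / 5"
      by (rule lagrangian_le) (use assms True x in \<open>auto simp: edge_colouring_def\<close>)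
    finally show ?thesis using T by simp
  next
    case False
    then obtain i j k a where ijk: "i \<in> I" "j \<in> I" "k \<in> I" "mono_triangle ?K a i j k"
      unfolding mono_triangle_free_def by blast
    have "(s i, s j, s k) \<in> mono_triangles K V"
      using ijk sV by (auto simp: mono_triangles_def mono_triangle_def)
    then have "(1 :: real) = (\<lambda>(i, j, k). of_bool ((s i, s j, s k) \<in> mono_triangles K V)) (i, j, k)"
      by simp
    also have "\<dots> \<le> ?T"
      by (rule member_le_sum) (use ijk assms(4) in auto)
    finally have "1 \<le> ?T" .
    moreover have "lagrangian ?K ?\<beta> I ?x \<le> (\<Sum>i\<in>I. \<Sum>j\<in>I. ?x i * ?x j) + (\<Sum>i\<in>I. ?x i * (4 / 5))"
      unfolding lagrangian_def
      by (intro add_mono sum_mono mult_left_mono divide_right_mono bonus_le) auto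
    moreover have "\<dots> = 1 + 4 / 5"
      using m by (simp flip: sum_distrib_left add: field_simps)
    ultimately show ?thesis by linarith
  qed
qed

lemma sum_bonus_ge:
  assumes "(\<Sum>v\<in>V. real (card (palette K V v))) \<le> 2 * real (card V)"
  shows "2 * real (card V) \<le> (\<Sum>v\<in>V. bonus (card (palette K V v)))"
proof -
  have "2 * real (card V) \<le> (\<Sum>v\<in>V. 4 - real (card (palette K V v)))"
    using assms by (simp add: sum_subtractf)
  also have "\<dots> \<le> (\<Sum>v\<in>V. bonus (card (palette K V v)))"
    by (intro sum_mono bonus_ge)
  finally show ?thesis .
qed

lemma sum_sample_mono_triangles_le:
  assumes "finite V" "V \<noteq> {}" "edge_colouring K" "finite I" "i \<in> I" "j \<in> I" "k \<in> I"
  shows "(\<Sum>s\<in>I \<rightarrow>\<^sub>E V. of_bool ((s i, s j, s k) \<in> mono_triangles K V))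
     \<le> real (card V) ^ card I * (real (card (mono_triangles K V)) / real (card V) ^ 3)"
proof (cases "i \<noteq> j \<and> i \<noteq> k \<and> j \<noteq> k")
  case True
  have N: "real (card V) > 0" using assms(1,2) by (simp add: card_gt_0_iff)
  have "card {i, j, k} \<le> card I" using assms by (intro card_mono) auto
  then have I: "card I = (card I - 3) + 3" using True by simp
  have "(\<Sum>s\<in>I \<rightarrow>\<^sub>E V. of_bool ((s i, s j, s k) \<in> mono_triangles K V)) =
      real (card V) ^ (card I - 3) *
        (\<Sum>x\<in>V. \<Sum>y\<in>V. \<Sum>z\<in>V. of_bool ((x, y, z) \<in> mono_triangles K V))"
    by (rule sum_PiE_three_coordinates) (use assms True in auto)
  also have "(\<Sum>x\<in>V. \<Sum>y\<in>V. \<Sum>z\<in>V. of_bool ((x, y, z) \<in> mono_triangles K V)) =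
      (\<Sum>p\<in>V\<times>V\<times>V. of_bool (p \<in> mono_triangles K V) :: real)"
    by (simp only: sum.cartesian_product case_prod_unfold prod.collapse)
  also have "\<dots> = real (card (mono_triangles K V))"
  proof -
    have "V \<times> V \<times> V \<inter> {p. p \<in> mono_triangles K V} = mono_triangles K V"
      by (auto simp: mono_triangles_def)
    then show ?thesis using assms(1) by simp
  qed
  also have "real (card V) ^ (card I - 3) = real (card V) ^ card I / real (card V) ^ 3"
    using N by (subst (2) I, subst power_add) simp
  finally show ?thesis by simp
next
  case False
  have "K v v = None" for v using assms(3) by (simp add: edge_colouring_def)
  then have "(s i, s j, s k) \<notin> mono_triangles K V" for s
    using False by (auto simp: mono_triangles_def mono_triangle_def)
  then show ?thesis by simp
qed

text \<open>Both sides of \<open>sample_lagrangian_le\<close> are averaged over all samples of size \<open>m\<close>. Pairs of equal indices account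
for the loss $1/m$, since a sample of size \<open>m\<close> has $m^2 - m$ ordered pairs of distinct indices.\<close>

theorem mono_triangle_supersaturation:
  assumes "finite V" "V \<noteq> {}" "edge_colouring K" "m > 0"
    and "(\<Sum>v\<in>V. real (card (palette K V v))) \<le> 2 * real (card V)"
  shows "real (card {(u, v). u \<in> V \<and> v \<in> V \<and> K u v \<noteq> None}) / real (card V) ^ 2
     \<le> 4 / 5 + 1 / real m + real m ^ 3 * (real (card (mono_triangles K V)) / real (card V) ^ 3)"
proof -
  define I where "I = {..<m}"
  define N where "N = real (card V)"
  define E where "E = real (card {(u, v). u \<in> V \<and> v \<in> V \<and> K u v \<noteq> None})"
  define t where "t = real (card (mono_triangles K V)) / N ^ 3"
  define M where "M = real m"
  have I: "finite I" "I \<noteq> {}" "card I = m" using assms(4) by (auto simp: I_def)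
  have N: "N > 0" using assms(1,2) by (simp add: N_def card_gt_0_iff)
  have M: "M > 0" using assms(4) by (simp add: M_def)
  let ?b = "\<lambda>v. bonus (card (palette K V v)) / 5"
  let ?S = "I \<rightarrow>\<^sub>E V"
  have cardS: "real (card ?S) = N ^ m" using I by (simp add: card_PiE N_def)
  have pairs: "(\<Sum>s\<in>?S. of_bool (K (s i) (s j) \<noteq> None)) = of_bool (i \<noteq> j) * (N ^ m * (E / N ^ 2))"
    if "i \<in> I" "j \<in> I" for i j
  proof (cases "i = j")
    case True
    then show ?thesis using assms(3) by (simp add: edge_colouring_def)
  next
    case False
    have "card {i, j} \<le> card I" using that I by (intro card_mono) auto
    then have m: "m = (m - 2) + 2" using False I by simp
    have "(\<Sum>s\<in>?S. of_bool (K (s i) (s j) \<noteq> None)) =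
        N ^ (m - 2) * (\<Sum>x\<in>V. \<Sum>y\<in>V. of_bool (K x y \<noteq> None))"
      using sum_PiE_two_coordinates[OF I(1) that False, of "\<lambda>x y. of_bool (K x y \<noteq> None)" V] I
      by (simp add: N_def)
    also have "(\<Sum>x\<in>V. \<Sum>y\<in>V. of_bool (K x y \<noteq> None)) =
        (\<Sum>p\<in>V\<times>V. of_bool (K (fst p) (snd p) \<noteq> None) :: real)"
      by (simp only: sum.cartesian_product case_prod_unfold)
    also have "\<dots> = real (card (V \<times> V \<inter> {p. K (fst p) (snd p) \<noteq> None}))"
      using assms(1) by (subst sum_of_bool_eq) auto
    also have "V \<times> V \<inter> {p. K (fst p) (snd p) \<noteq> None} = {(u, v). u \<in> V \<and> v \<in> V \<and> K u v \<noteq> None}"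
      by auto
    also have "N ^ (m - 2) = N ^ m / N ^ 2"
      using N by (subst (2) m, subst power_add) simp
    finally show ?thesis using False by (simp add: E_def)
  qed
  have "(\<Sum>s\<in>?S. lagrangian (\<lambda>i j. K (s i) (s j)) (\<lambda>i. ?b (s i)) I (\<lambda>_. 1 / M)) =
      (\<Sum>i\<in>I. \<Sum>j\<in>I. 1 / M * (1 / M) * (\<Sum>s\<in>?S. of_bool (K (s i) (s j) \<noteq> None))) +
      (\<Sum>i\<in>I. 1 / M * (\<Sum>s\<in>?S. ?b (s i)))"
  proof -
    have swap: "(\<Sum>s\<in>?S. \<Sum>i\<in>I. \<Sum>j\<in>I. of_bool (K (s i) (s j) \<noteq> None) * (1 / M) * (1 / M)) =
        (\<Sum>i\<in>I. \<Sum>j\<in>I. \<Sum>s\<in>?S. of_bool (K (s i) (s j) \<noteq> None) * (1 / M) * (1 / M))"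
      by (subst sum.swap, intro sum.cong refl, rule sum.swap)
    show ?thesis
      unfolding lagrangian_def sum.distrib swap
      by (subst sum.swap[of _ I ?S]) (simp only: sum_distrib_left mult_ac)
  qed
  also have "(\<Sum>i\<in>I. \<Sum>j\<in>I. 1 / M * (1 / M) * (\<Sum>s\<in>?S. of_bool (K (s i) (s j) \<noteq> None))) =
      (\<Sum>i\<in>I. \<Sum>j\<in>I. 1 / M * (1 / M) * (of_bool (i \<noteq> j) * (N ^ m * (E / N ^ 2))))"
    by (intro sum.cong refl) (simp only: pairs)
  also have "\<dots> = (1 - 1 / M) * (N ^ m * (E / N ^ 2))"
  proof -
    have "(\<Sum>j\<in>I. of_bool (i \<noteq> j)) = M - 1" if "i \<in> I" for i
    proof -
      have "I \<inter> {j. i \<noteq> j} = I - {i}" by auto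
      then show ?thesis using that I assms(4) by (simp add: M_def of_nat_diff)
    qed
    then have "(\<Sum>i\<in>I. \<Sum>j\<in>I. 1 / M * (1 / M) * (of_bool (i \<noteq> j) * (N ^ m * (E / N ^ 2)))) =
        (\<Sum>i\<in>I. 1 / M * (1 / M) * ((M - 1) * (N ^ m * (E / N ^ 2))))"
      by (simp only: sum_distrib_left[symmetric] sum_distrib_right[symmetric] cong: sum.cong)
    also have "\<dots> = M * (1 / M * (1 / M) * ((M - 1) * (N ^ m * (E / N ^ 2))))"
      using I by (simp add: M_def)
    also have "\<dots> = (1 - 1 / M) * (N ^ m * (E / N ^ 2))"
    proof -
      have "M * (1 / M * (1 / M) * ((M - 1) * c)) = (1 - 1 / M) * c" for c
        using M by (simp add: field_simps)
      then show ?thesis .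
    qed
    finally show ?thesis .
  qed
  also have "(\<Sum>i\<in>I. 1 / M * (\<Sum>s\<in>?S. ?b (s i))) = N ^ m * ((\<Sum>v\<in>V. ?b v) / N)"
  proof -
    have "N ^ (m - 1) = N ^ m / N"
      using N assms(4) by (cases m) auto
    then have "(\<Sum>s\<in>?S. ?b (s i)) = N ^ m * ((\<Sum>v\<in>V. ?b v) / N)" if "i \<in> I" for i
      using sum_PiE_one_coordinate[OF I(1) that, of ?b V] I by (simp add: N_def)
    then have "(\<Sum>i\<in>I. 1 / M * (\<Sum>s\<in>?S. ?b (s i))) = (\<Sum>i\<in>I. 1 / M * (N ^ m * ((\<Sum>v\<in>V. ?b v) / N)))"
      by (intro sum.cong) simp_all
    also have "\<dots> = N ^ m * ((\<Sum>v\<in>V. ?b v) / N)"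
      using I M by (simp add: M_def)
    finally show ?thesis .
  qed
  finally have total: "(\<Sum>s\<in>?S. lagrangian (\<lambda>i j. K (s i) (s j)) (\<lambda>i. ?b (s i)) I (\<lambda>_. 1 / M)) =
     N ^ m * ((1 - 1 / M) * (E / N ^ 2) + (\<Sum>v\<in>V. ?b v) / N)"
    by (simp add: algebra_simps)
  have "(\<Sum>s\<in>?S. lagrangian (\<lambda>i j. K (s i) (s j)) (\<lambda>i. ?b (s i)) I (\<lambda>_. 1 / M)) \<le>
      (\<Sum>s\<in>?S. 6 / 5 + (\<Sum>(i, j, k)\<in>I\<times>I\<times>I. of_bool ((s i, s j, s k) \<in> mono_triangles K V)))"
    using sample_lagrangian_le[OF assms(1,3) _ I(1,2)] I by (intro sum_mono) (simp add: M_def)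
  also have "\<dots> = N ^ m * (6 / 5) +
      (\<Sum>(i, j, k)\<in>I\<times>I\<times>I. \<Sum>s\<in>?S. of_bool ((s i, s j, s k) \<in> mono_triangles K V))"
    unfolding case_prod_unfold sum.distrib by (subst sum.swap) (simp add: cardS)
  also have "\<dots> \<le> N ^ m * (6 / 5) + (\<Sum>(i, j, k)\<in>I\<times>I\<times>I. N ^ m * t)"
    using sum_sample_mono_triangles_le[OF assms(1-3) I(1)] I
    by (intro add_left_mono sum_mono) (auto simp: N_def t_def)
  also have "\<dots> = N ^ m * (6 / 5 + M ^ 3 * t)"
    using I by (simp add: card_cartesian_product M_def algebra_simps power3_eq_cube)
  finally have "(1 - 1 / M) * (E / N ^ 2) + (\<Sum>v\<in>V. ?b v) / N \<le> 6 / 5 + M ^ 3 * t"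
    unfolding total using N by simp
  moreover have "2 / 5 \<le> (\<Sum>v\<in>V. ?b v) / N"
    using sum_bonus_ge[OF assms(5)] N by (simp flip: sum_divide_distrib add: N_def field_simps)
  moreover have "E / N ^ 2 / M \<le> 1 / M"
  proof -
    have "card {(u, v). u \<in> V \<and> v \<in> V \<and> K u v \<noteq> None} \<le> card (V \<times> V)"
      using assms(1) by (intro card_mono) auto
    then have "E \<le> N ^ 2"
      unfolding E_def N_def by (simp add: card_cartesian_product power2_eq_square flip: of_nat_mult)
    then show ?thesis using N M by (intro divide_right_mono) auto
  qed
  moreover have "(1 - 1 / M) * (E / N ^ 2) = E / N ^ 2 - E / N ^ 2 / M"
    by (simp add: left_diff_distrib diff_divide_distrib)
  ultimately have "E / N ^ 2 \<le> 4 / 5 + 1 / M + M ^ 3 * t" by linarith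
  then show ?thesis by (simp add: E_def N_def t_def M_def)
qed

section \<open>Monochromatic complete tripartite subgraphs\<close>

text \<open>A reverse Markov inequality: if the average is large, then so is the set of large values.\<close>

lemma sum_le_popular:
  fixes f :: "'x \<Rightarrow> real"
  assumes "finite X" "\<And>x. x \<in> X \<Longrightarrow> f x \<le> B" "0 \<le> \<tau>"
  shows "(\<Sum>x\<in>X. f x) \<le> B * real (card {x\<in>X. \<tau> \<le> f x}) + \<tau> * real (card X)"
proof -
  have "(\<Sum>x\<in>X. f x) \<le> (\<Sum>x\<in>X. B * of_bool (\<tau> \<le> f x) + \<tau>)"
  proof (rule sum_mono)
    fix x assume "x \<in> X"
    then show "f x \<le> B * of_bool (\<tau> \<le> f x) + \<tau>"
      using assms(2)[of x] assms(3) by (cases "\<tau> \<le> f x") auto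
  qed
  also have "\<dots> = B * real (card {x\<in>X. \<tau> \<le> f x}) + \<tau> * real (card X)"
    using assms(1) by (simp add: sum.distrib Int_def flip: sum_distrib_left)
  finally show ?thesis .
qed

text \<open>The number of vertices chosen in \<open>X\<close> is fixed, but the common neighbourhood keeps a positive proportion of \<open>Y\<close>; this
makes the lemma usable with $Y = V \times V$ and then again inside the set of pairs that it returns.

Among boundedly many vertices of large degree, a positive proportion of all $y \in Y$ has at least \<open>t\<close> neighbours,
and by pigeonhole many of these $y$ share \<open>t\<close> common neighbours.\<close>

lemma rich_common_neighbourhood:
  fixes \<delta> :: real and t :: nat
  assumes "\<delta> > 0"
  shows "\<exists>\<gamma>>0. \<exists>n0. \<forall>(X :: 'x set) (Y :: 'y set) R.
    finite X \<and> finite Y \<and> n0 \<le> card X \<and> R \<subseteq> X \<times> Y \<and> \<delta> * real (card X) * real (card Y) \<le> real (card R)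
    \<longrightarrow> (\<exists>A\<subseteq>X. card A = t \<and> \<gamma> * real (card Y) \<le> real (card {y\<in>Y. \<forall>x\<in>A. (x, y) \<in> R}))"
proof -
  \<comment> \<open>With this many chosen vertices, those $y$ with fewer than \<open>t\<close> neighbours use up at most half of the incidences.\<close>
  define M where "M = Suc (nat \<lceil>4 * real t / \<delta>\<rceil>)"
  have M: "real t \<le> real M * (\<delta> / 4)" "M > 0"
  proof -
    have "4 * real t / \<delta> \<le> real M" unfolding M_def by linarith
    then show "real t \<le> real M * (\<delta> / 4)" using assms by (simp add: field_simps)
  qed (simp add: M_def)
  define \<gamma> where "\<gamma> = \<delta> / 4 / 2 ^ M"
  define n0 where "n0 = t + nat \<lceil>2 * real M / \<delta>\<rceil>"
  have "\<exists>A\<subseteq>X. card A = t \<and> \<gamma> * real (card Y) \<le> real (card {y\<in>Y. \<forall>x\<in>A. (x, y) \<in> R})"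
    if fin: "finite X" "finite Y" and large: "n0 \<le> card X" and R: "R \<subseteq> X \<times> Y"
      and dense: "\<delta> * real (card X) * real (card Y) \<le> real (card R)"
    for X :: "'x set" and Y :: "'y set" and R
  proof (cases "Y = {}")
    case True
    obtain A where "A \<subseteq> X" "card A = t"
      using obtain_subset_with_card_n[of t X] large by (auto simp: n0_def)
    then show ?thesis using True by auto
  next
    case False
    define N where "N = real (card Y)"
    have N: "N > 0" using False fin by (simp add: N_def card_gt_0_iff)
    define d where "d x = real (card {y\<in>Y. (x, y) \<in> R})" for x
    have d_le: "d x \<le> N" for x
      unfolding d_def N_def using fin by (auto intro!: card_mono)
    have "R = (SIGMA x:X. {y\<in>Y. (x, y) \<in> R})" using R by auto
    then have "real (card R) = (\<Sum>x\<in>X. d x)"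
      unfolding d_def using card_SigmaI[OF fin(1), of "\<lambda>x. {y\<in>Y. (x, y) \<in> R}"] fin by simp
    also have "\<dots> \<le> N * real (card {x\<in>X. \<delta> / 2 * N \<le> d x}) + \<delta> / 2 * N * real (card X)"
      using d_le N assms fin by (intro sum_le_popular) auto
    finally have "N * (\<delta> / 2 * real (card X)) \<le> N * real (card {x\<in>X. \<delta> / 2 * N \<le> d x})"
      using dense by (simp add: N_def algebra_simps)
    then have "\<delta> / 2 * real (card X) \<le> real (card {x\<in>X. \<delta> / 2 * N \<le> d x})"
      using N by simp
    moreover have "real M \<le> \<delta> / 2 * real (card X)"
    proof -
      have "2 * real M / \<delta> \<le> real (card X)" using large unfolding n0_def by linarith
      then show ?thesis using assms by (simp add: field_simps)
    qed
    ultimately have "M \<le> card {x\<in>X. \<delta> / 2 * N \<le> d x}" by linarith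
    from obtain_subset_with_card_n[OF this]
    obtain S where S: "S \<subseteq> {x\<in>X. \<delta> / 2 * N \<le> d x}" "card S = M" "finite S" .
    define e where "e y = real (card {x\<in>S. (x, y) \<in> R})" for y
    define Y' where "Y' = {y\<in>Y. real t \<le> e y}"
    have "real M * (\<delta> / 2 * N) \<le> (\<Sum>x\<in>S. d x)"
      using S(1,2) sum_mono[of S "\<lambda>_. \<delta> / 2 * N" d] by auto
    also have "\<dots> = (\<Sum>y\<in>Y. e y)"
      unfolding d_def e_def using sum_multicount_gen[OF fin(2) S(3), of "\<lambda>y x. (x, y) \<in> R" "\<lambda>x. card {y\<in>Y. (x, y) \<in> R}"]
      by (simp flip: of_nat_sum)
    also have "\<dots> \<le> real M * real (card Y') + real t * N"
      unfolding Y'_def N_def using S(2,3) fin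
      by (intro sum_le_popular) (auto simp: e_def intro!: card_mono)
    finally have "real M * (\<delta> / 2 * N) \<le> real M * real (card Y') + real M * (\<delta> / 4) * N"
      using mult_right_mono[OF M(1), of N] N by linarith
    then have "real M * (\<delta> / 4 * N) \<le> real M * real (card Y')" by (simp add: algebra_simps)
    then have Y'_large: "\<delta> / 4 * N \<le> real (card Y')" using M(2) by simp
    \<comment> \<open>Pigeonhole: every popular $y$ is joined to some \<open>t\<close>-subset of \<open>S\<close>, and there are at most $2^M$ of these.\<close>
    define \<A> where "\<A> = {A. A \<subseteq> S \<and> card A = t}"
    define C where "C A = {y\<in>Y. \<forall>x\<in>A. (x, y) \<in> R}" for A
    have \<A>: "finite \<A>" "card \<A> \<le> 2 ^ M"
    proof -
      have "\<A> \<subseteq> Pow S" by (auto simp: \<A>_def)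
      then show "finite \<A>" "card \<A> \<le> 2 ^ M"
        using S(2,3) card_mono[of "Pow S" \<A>] by (auto simp: card_Pow intro: finite_subset)
    qed
    have cover: "Y' \<subseteq> (\<Union>A\<in>\<A>. C A)"
    proof
      fix y assume y: "y \<in> Y'"
      then have "t \<le> card {x\<in>S. (x, y) \<in> R}" by (simp add: Y'_def e_def)
      from obtain_subset_with_card_n[OF this]
      obtain A where "A \<subseteq> {x\<in>S. (x, y) \<in> R}" "card A = t" .
      then show "y \<in> (\<Union>A\<in>\<A>. C A)" using y by (auto simp: \<A>_def C_def Y'_def)
    qed
    have "\<exists>A\<in>\<A>. \<gamma> * N \<le> real (card (C A))"
    proof (rule ccontr)
      assume "\<not> ?thesis"
      then have less: "real (card (C A)) < \<gamma> * N" if "A \<in> \<A>" for A using that by force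
      have "Y' \<noteq> {}" using Y'_large assms N by (auto simp: mult_le_0_iff)
      then have ne: "\<A> \<noteq> {}" using cover by auto
      have "card Y' \<le> (\<Sum>A\<in>\<A>. card (C A))"
        using \<A>(1) cover fin card_mono[OF _ cover] card_UN_le[OF \<A>(1), of C] by (force simp: C_def)
      then have "real (card Y') \<le> (\<Sum>A\<in>\<A>. real (card (C A)))"
        by (simp flip: of_nat_sum)
      also have "\<dots> < (\<Sum>A\<in>\<A>. \<gamma> * N)"
        by (rule sum_strict_mono) (use \<A> ne less in auto)
      also have "\<dots> \<le> 2 ^ M * (\<gamma> * N)"
      proof -
        have "real (card \<A>) \<le> 2 ^ M" using \<A>(2) by (metis of_nat_le_iff of_nat_numeral of_nat_power)
        then have "real (card \<A>) * (\<gamma> * N) \<le> 2 ^ M * (\<gamma> * N)"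
          by (rule mult_right_mono) (use N assms in \<open>simp add: \<gamma>_def\<close>)
        then show ?thesis by simp
      qed
      also have "\<dots> = \<delta> / 4 * N" by (simp add: \<gamma>_def)
      finally show False using Y'_large by simp
    qed
    then obtain A where "A \<in> \<A>" "\<gamma> * N \<le> real (card (C A))" by blast
    then show ?thesis using S(1) by (intro exI[of _ A]) (auto simp: \<A>_def C_def N_def)
  qed
  moreover have "\<gamma> > 0" using assms by (simp add: \<gamma>_def)
  ultimately show ?thesis by blast
qed

lemma dense_ternary_relation_contains_box:
  fixes \<delta> :: real and t :: nat
  assumes "\<delta> > 0"
  shows "\<exists>n0. \<forall>(V :: 'v set) T. finite V \<and> n0 \<le> card V \<and> T \<subseteq> V \<times> V \<times> V \<and>
      \<delta> * real (card V) ^ 3 \<le> real (card T)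
    \<longrightarrow> (\<exists>A B C. A \<subseteq> V \<and> B \<subseteq> V \<and> C \<subseteq> V \<and> card A = t \<and> card B = t \<and> card C = t \<and> A \<times> B \<times> C \<subseteq> T)"
proof -
  obtain \<gamma> n1 where \<gamma>: "\<gamma> > 0" and n1: "\<forall>(X :: 'v set) (Y :: ('v \<times> 'v) set) R.
    finite X \<and> finite Y \<and> n1 \<le> card X \<and> R \<subseteq> X \<times> Y \<and> \<delta> * real (card X) * real (card Y) \<le> real (card R)
    \<longrightarrow> (\<exists>A\<subseteq>X. card A = t \<and> \<gamma> * real (card Y) \<le> real (card {y\<in>Y. \<forall>x\<in>A. (x, y) \<in> R}))"
    using rich_common_neighbourhood[OF assms, of t, where 'x = 'v and 'y = "'v \<times> 'v"] by blast
  obtain \<gamma>' n2 where \<gamma>': "\<gamma>' > 0" and n2: "\<forall>(X :: 'v set) (Y :: 'v set) R.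
    finite X \<and> finite Y \<and> n2 \<le> card X \<and> R \<subseteq> X \<times> Y \<and> \<gamma> * real (card X) * real (card Y) \<le> real (card R)
    \<longrightarrow> (\<exists>A\<subseteq>X. card A = t \<and> \<gamma>' * real (card Y) \<le> real (card {y\<in>Y. \<forall>x\<in>A. (x, y) \<in> R}))"
    using rich_common_neighbourhood[OF \<gamma>, of t, where 'x = 'v and 'y = "'v"] by blast
  define n0 where "n0 = n1 + n2 + nat \<lceil>real t / \<gamma>'\<rceil>"
  have "\<exists>A B C. A \<subseteq> V \<and> B \<subseteq> V \<and> C \<subseteq> V \<and> card A = t \<and> card B = t \<and> card C = t \<and> A \<times> B \<times> C \<subseteq> T"
    if V: "finite V" "n0 \<le> card V" and T: "T \<subseteq> V \<times> V \<times> V" "\<delta> * real (card V) ^ 3 \<le> real (card T)"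
    for V :: "'v set" and T
  proof -
    have "\<delta> * real (card V) * real (card (V \<times> V)) \<le> real (card T)"
      using T(2) by (simp add: card_cartesian_product power3_eq_cube mult.assoc)
    then obtain A where A: "A \<subseteq> V" "card A = t"
      "\<gamma> * real (card (V \<times> V)) \<le> real (card {p\<in>V\<times>V. \<forall>x\<in>A. (x, p) \<in> T})"
      using n1[rule_format, of V "V \<times> V" T] V T(1) by (auto simp: n0_def)
    define T' where "T' = {p\<in>V\<times>V. \<forall>x\<in>A. (x, p) \<in> T}"
    have "\<gamma> * real (card V) * real (card V) \<le> real (card T')"
      using A(3) by (simp add: T'_def card_cartesian_product mult.assoc)
    moreover have "T' \<subseteq> V \<times> V" by (auto simp: T'_def)
    ultimately obtain B where B: "B \<subseteq> V" "card B = t"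
      "\<gamma>' * real (card V) \<le> real (card {z\<in>V. \<forall>y\<in>B. (y, z) \<in> T'})"
      using n2[rule_format, of V V T'] V by (auto simp: n0_def)
    have "real t / \<gamma>' \<le> real (card V)" using V(2) unfolding n0_def by linarith
    then have "real t \<le> \<gamma>' * real (card V)" using \<gamma>' by (simp add: field_simps)
    then have "t \<le> card {z\<in>V. \<forall>y\<in>B. (y, z) \<in> T'}" using B(3) by linarith
    from obtain_subset_with_card_n[OF this]
    obtain C where C: "C \<subseteq> {z\<in>V. \<forall>y\<in>B. (y, z) \<in> T'}" "card C = t" .
    from C have "A \<times> B \<times> C \<subseteq> T" unfolding T'_def by blast
    then show ?thesis using A(1,2) B(1,2) C by blast
  qed
  then show ?thesis by blast
qed

text \<open>Let $n_a$ be the number of vertices incident with colour \<open>a\<close> and $T_a$ the set of triangles of that colour.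
From $\sum_a n_a \le 2n$ and $\sum_a |T_a| \ge \delta n^3$ some colour satisfies
$|T_a| \ge \frac\delta2 n^2 n_a$. Since $|T_a| \le n_a^3 \le n_a^2 n$, this colour also has
$n_a \ge \frac\delta2 n$.\<close>

lemma dominant_colour:
  assumes "finite V" "edge_colouring K" "V \<noteq> {}" "\<delta> > 0"
    and few: "(\<Sum>v\<in>V. real (card (palette K V v))) \<le> 2 * real (card V)"
    and many: "\<delta> * real (card V) ^ 3 \<le> real (card (mono_triangles K V))"
  shows "\<exists>a. (\<delta> / 2)\<^sup>2 * real (card V) ^ 3
    \<le> real (card {(x, y, z). x \<in> V \<and> y \<in> V \<and> z \<in> V \<and> mono_triangle K a x y z})"
proof -
  define N where "N = real (card V)"
  have N: "N > 0" using assms(1,3) by (simp add: N_def card_gt_0_iff)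
  define P where "P = (\<Union>v\<in>V. palette K V v)"
  define U where "U a = {v\<in>V. a \<in> palette K V v}" for a
  define T where "T a = {(x, y, z). x \<in> V \<and> y \<in> V \<and> z \<in> V \<and> mono_triangle K a x y z}" for a
  have P: "finite P" unfolding P_def using assms(1) by (simp add: finite_palette)
  have TU: "T a \<subseteq> U a \<times> U a \<times> U a" for a
  proof
    fix p assume "p \<in> T a"
    then obtain x y z where p: "p = (x, y, z)" "x \<in> V" "y \<in> V" "z \<in> V"
      and xyz: "K x y = Some a" "K y z = Some a" "K x z = Some a"
      by (auto simp: T_def mono_triangle_def)
    moreover have "K z x = Some a" using xyz(3) assms(2) by (simp add: edge_colouring_def)
    ultimately show "p \<in> U a \<times> U a \<times> U a" by (auto simp: U_def palette_def)
  qed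
  have finT: "finite (T a)" for a
    by (rule finite_subset[OF TU]) (use assms(1) in \<open>simp add: U_def\<close>)
  have cover: "mono_triangles K V \<subseteq> (\<Union>a\<in>P. T a)"
    by (auto simp: mono_triangles_def T_def P_def palette_def mono_triangle_def)
  have "(\<Sum>a\<in>P. real (card (U a))) = (\<Sum>v\<in>V. real (card (palette K V v)))"
  proof -
    have "{a\<in>P. a \<in> palette K V v} = palette K V v" if "v \<in> V" for v
      using that by (auto simp: P_def)
    then have "(\<Sum>v\<in>V. card (palette K V v)) = (\<Sum>a\<in>P. card (U a))"
      unfolding U_def
      using sum_multicount_gen[OF assms(1) P, of "\<lambda>v a. a \<in> palette K V v" "\<lambda>a. card {v\<in>V. a \<in> palette K V v}"]
      by simp
    then show ?thesis by (simp flip: of_nat_sum)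
  qed
  then have U_sum: "(\<Sum>a\<in>P. real (card (U a))) \<le> 2 * N" using few by (simp add: N_def)
  have "\<exists>a\<in>P. \<delta> / 2 * N\<^sup>2 * real (card (U a)) \<le> real (card (T a))"
  proof (rule ccontr)
    assume "\<not> ?thesis"
    then have less: "real (card (T a)) < \<delta> / 2 * N\<^sup>2 * real (card (U a))" if "a \<in> P" for a
      using that by force
    have "0 < \<delta> * N ^ 3" using assms(4) N by simp
    then have "mono_triangles K V \<noteq> {}" using many by (auto simp: N_def)
    then have ne: "P \<noteq> {}" using cover by auto
    have "card (mono_triangles K V) \<le> (\<Sum>a\<in>P. card (T a))"
      using card_mono[OF _ cover] card_UN_le[OF P, of T] finT P by (meson finite_UN_I le_trans)
    then have "real (card (mono_triangles K V)) \<le> (\<Sum>a\<in>P. real (card (T a)))"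
      by (simp flip: of_nat_sum)
    also have "\<dots> < (\<Sum>a\<in>P. \<delta> / 2 * N\<^sup>2 * real (card (U a)))"
      by (rule sum_strict_mono) (use P ne less in auto)
    also have "\<dots> \<le> \<delta> / 2 * N\<^sup>2 * (2 * N)"
      unfolding sum_distrib_left[symmetric] using U_sum assms(4) by (intro mult_left_mono) auto
    also have "\<dots> = \<delta> * N ^ 3" by (simp add: power2_eq_square power3_eq_cube)
    finally show False using many by (simp add: N_def)
  qed
  then obtain a where a: "a \<in> P" "\<delta> / 2 * N\<^sup>2 * real (card (U a)) \<le> real (card (T a))" by blast
  define u where "u = real (card (U a))"
  have finU: "finite (U a)" using assms(1) by (simp add: U_def)
  have "u > 0"
    using a(1) finU by (auto simp: u_def U_def P_def card_gt_0_iff)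
  have "card (T a) \<le> card (U a \<times> U a \<times> U a)"
    by (rule card_mono) (use finU TU in auto)
  then have "real (card (T a)) \<le> u * (u * u)"
    unfolding u_def card_cartesian_product by (metis of_nat_le_iff of_nat_mult)
  then have "u * (\<delta> / 2 * N\<^sup>2) \<le> u * (u * u)" using a(2) by (simp add: u_def mult.commute)
  then have "\<delta> / 2 * N\<^sup>2 \<le> u * u" using \<open>u > 0\<close> by simp
  also have "\<dots> \<le> u * N"
    using assms(1) \<open>u > 0\<close> by (intro mult_left_mono) (auto simp: u_def N_def U_def intro!: card_mono)
  finally have "\<delta> / 2 * N \<le> u" using N by (simp add: power2_eq_square)
  then have "\<delta> / 2 * N\<^sup>2 * (\<delta> / 2 * N) \<le> \<delta> / 2 * N\<^sup>2 * u"
    using assms(4) by (intro mult_left_mono) auto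
  also have "\<dots> \<le> real (card (T a))" using a(2) by (simp add: u_def)
  finally have "(\<delta> / 2)\<^sup>2 * N ^ 3 \<le> real (card (T a))"
    by (simp add: power2_eq_square power3_eq_cube algebra_simps)
  then show ?thesis by (auto simp: T_def N_def)
qed

section \<open>Coloured simple graphs\<close>

definition graph_colouring :: "'v ugraph \<Rightarrow> ('v set \<Rightarrow> 'c) \<Rightarrow> 'v \<Rightarrow> 'v \<Rightarrow> 'c option" where
  "graph_colouring G c u v = (if {u, v} \<in> edges G then Some (c {u, v}) else None)"

lemma simple_graph_edgeD:
  assumes "simple_graph G" "{u, v} \<in> edges G"
  shows "u \<noteq> v" "u \<in> verts G" "v \<in> verts G"
  using assms by (auto simp: simple_graph_def)

lemma simple_graph_edgeE:
  assumes "simple_graph G" "e \<in> edges G"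
  obtains u v where "e = {u, v}" "u \<noteq> v" "u \<in> verts G" "v \<in> verts G"
  using assms by (auto simp: simple_graph_def card_2_iff)

lemma edge_colouring_graph_colouring:
  assumes "simple_graph G"
  shows "edge_colouring (graph_colouring G c)"
  unfolding edge_colouring_def
proof (intro conjI allI)
  show "graph_colouring G c u v = graph_colouring G c v u" for u v
    by (simp add: graph_colouring_def insert_commute)
  show "graph_colouring G c u u = None" for u
    using simple_graph_edgeD(1)[OF assms, of u u] by (auto simp: graph_colouring_def)
qed

lemma palette_graph_colouring:
  assumes "simple_graph G"
  shows "palette (graph_colouring G c) (verts G) v = incident_colors G c v"
proof
  show "palette (graph_colouring G c) (verts G) v \<subseteq> incident_colors G c v"
    by (auto simp: palette_def graph_colouring_def incident_colors_def split: if_splits)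
  show "incident_colors G c v \<subseteq> palette (graph_colouring G c) (verts G) v"
  proof
    fix a assume "a \<in> incident_colors G c v"
    then obtain e where e: "e \<in> edges G" "v \<in> e" "a = c e"
      by (auto simp: incident_colors_def)
    obtain u where "e = {v, u}" "u \<in> verts G"
      using simple_graph_edgeE[OF assms e(1)] e(2) by (metis insertE insert_commute singletonD)
    then show "a \<in> palette (graph_colouring G c) (verts G) v"
      using e by (auto simp: palette_def graph_colouring_def)
  qed
qed

lemma finite_edges: "simple_graph G \<Longrightarrow> finite (edges G)"
  by (rule finite_subset[of _ "Pow (verts G)"]) (auto simp: simple_graph_def)

lemma card_adjacent_pairs:
  assumes "simple_graph G"
  shows "card {(u, v). {u, v} \<in> edges G} = 2 * card (edges G)"
proof -
  have "{(u, v). {u, v} \<in> edges G} = (\<Union>e\<in>edges G. {(u, v). {u, v} = e})"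
    by auto
  also have "card \<dots> = (\<Sum>e\<in>edges G. card {(u, v). {u, v} = e})"
  proof (rule card_UN_disjoint[OF finite_edges[OF assms]])
    show "\<forall>e\<in>edges G. finite {(u, v). {u, v} = e}"
    proof
      fix e assume "e \<in> edges G"
      then have "finite e" using assms by (meson finite_subset simple_graph_def)
      then have "finite (e \<times> e)" by simp
      then show "finite {(u, v). {u, v} = e}" by (rule rev_finite_subset) auto
    qed
  qed auto
  also have "\<dots> = (\<Sum>e\<in>edges G. 2)"
  proof (rule sum.cong[OF refl])
    fix e assume "e \<in> edges G"
    then obtain x y where "e = {x, y}" "x \<noteq> y"
      using simple_graph_edgeE[OF assms] by metis
    then have "{(u, v). {u, v} = e} = {(x, y), (y, x)}" "(x, y) \<noteq> (y, x)"
      by (auto simp: doubleton_eq_iff)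
    then show "card {(u, v). {u, v} = e} = 2" by simp
  qed
  finally show ?thesis by simp
qed

lemma card_coloured_pairs:
  assumes "simple_graph G"
  shows "card {(u, v). u \<in> verts G \<and> v \<in> verts G \<and> graph_colouring G c u v \<noteq> None} = 2 * card (edges G)"
proof -
  have "{(u, v). u \<in> verts G \<and> v \<in> verts G \<and> graph_colouring G c u v \<noteq> None} =
      {(u, v). {u, v} \<in> edges G}"
    using simple_graph_edgeD[OF assms] by (auto simp: graph_colouring_def)
  then show ?thesis using card_adjacent_pairs[OF assms] by simp
qed

text \<open>Each colour class of \<open>H\<close> is mapped injectively into its own part. The parts are automatically disjoint, as adjacent
vertices are distinct.\<close>

lemma has_mono_copy_if_mono_box:
  assumes H: "simple_graph H" "proper_vertex_coloring H 3 f" and G: "simple_graph G"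
    and parts: "A \<subseteq> verts G" "B \<subseteq> verts G" "C \<subseteq> verts G"
      "card A = card (verts H)" "card B = card (verts H)" "card C = card (verts H)"
    and mono: "\<And>x y z. x \<in> A \<Longrightarrow> y \<in> B \<Longrightarrow> z \<in> C \<Longrightarrow> mono_triangle (graph_colouring G c) a x y z"
  shows "has_mono_copy G c H"
proof -
  define P where "P i = (if i = 0 then A else if i = 1 then B else C)" for i :: nat
  have finH: "finite (verts H)" and finG: "finite (verts G)"
    using H(1) G by (auto simp: simple_graph_def)
  have PG: "P i \<subseteq> verts G" and cardP: "card (P i) = card (verts H)" for i
    using parts by (auto simp: P_def)
  have f3: "f v < 3" if "v \<in> verts H" for v
    using H(2) that by (auto simp: proper_vertex_coloring_def)
  have ne: "A \<noteq> {}" "B \<noteq> {}" "C \<noteq> {}" if "verts H \<noteq> {}"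
    using parts that finH by auto
  have comm: "graph_colouring G c u v = graph_colouring G c v u" for u v
    by (simp add: graph_colouring_def insert_commute)
  have cross: "graph_colouring G c x y = Some a"
    if ne': "verts H \<noteq> {}" and ij: "i < 3" "j < 3" "i \<noteq> j" and xy: "x \<in> P i" "y \<in> P j" for i j x y
  proof -
    \<comment> \<open>The hypothesis only speaks of triangles, so an edge between two parts needs a witness in the third.\<close>
    obtain a0 b0 c0 where "a0 \<in> A" "b0 \<in> B" "c0 \<in> C" using ne[OF ne'] by blast
    moreover have "i = 0 \<or> i = 1 \<or> i = 2" "j = 0 \<or> j = 1 \<or> j = 2" using ij by auto
    ultimately have "graph_colouring G c x y = Some a \<or> graph_colouring G c y x = Some a"
      using ij(3) xy mono unfolding P_def mono_triangle_def by (auto split: if_splits)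
    then show ?thesis using comm[of x y] by simp
  qed
  have "\<exists>g. bij_betw g (verts H) (P i)" for i
    using finite_same_card_bij[of "verts H" "P i"] finH finG PG cardP finite_subset by metis
  then obtain g where g: "\<And>i. bij_betw (g i) (verts H) (P i)" by metis
  define \<phi> where "\<phi> v = g (f v) v" for v
  have \<phi>P: "\<phi> v \<in> P (f v)" if "v \<in> verts H" for v
    using g[of "f v"] that by (auto simp: \<phi>_def bij_betw_def)
  have adj: "{\<phi> u, \<phi> v} \<in> edges G \<and> c {\<phi> u, \<phi> v} = a"
    if "u \<in> verts H" "v \<in> verts H" "f u \<noteq> f v" for u v
  proof -
    have "verts H \<noteq> {}" using that(1) by auto
    from cross[OF this f3 f3 that(3) \<phi>P \<phi>P] that
    show ?thesis by (auto simp: graph_colouring_def split: if_splits)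
  qed
  have inj: "inj_on \<phi> (verts H)"
  proof (rule inj_onI)
    fix u v assume uv: "u \<in> verts H" "v \<in> verts H" "\<phi> u = \<phi> v"
    have "f u = f v"
    proof (rule ccontr)
      assume "f u \<noteq> f v"
      then have "{\<phi> u, \<phi> v} \<in> edges G" using adj uv by blast
      then show False using simple_graph_edgeD(1)[OF G] uv(3) by blast
    qed
    then show "u = v"
      using uv g[of "f u"] by (auto simp: \<phi>_def bij_betw_def inj_on_def)
  qed
  have edge: "\<phi> ` e \<in> edges G \<and> c (\<phi> ` e) = a" if e: "e \<in> edges H" for e
  proof -
    obtain u v where uv: "e = {u, v}" "u \<in> verts H" "v \<in> verts H"
      using simple_graph_edgeE[OF H(1) e] by metis
    then have "f u \<noteq> f v" using H(2) e by (auto simp: proper_vertex_coloring_def)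
    then show ?thesis using adj uv by simp
  qed
  let ?S = "(\<phi> ` verts H, (`) \<phi> ` edges H)"
  have sub: "e \<subseteq> verts H" "card e = 2" if "e \<in> edges H" for e
    using H(1) that by (auto simp: simple_graph_def)
  have "card (\<phi> ` e) = 2" if "e \<in> edges H" for e
    using sub[OF that] inj by (simp add: card_image inj_on_subset)
  then have "simple_graph ?S"
    using finH sub by (auto simp: simple_graph_def)
  moreover have "\<phi> ` verts H \<subseteq> verts G" using \<phi>P PG by blast
  ultimately have "subgraph ?S G" using edge by (auto simp: subgraph_def)
  moreover have "isomorphic H ?S"
    unfolding isomorphic_def using inj by (intro exI[of _ \<phi>]) (auto simp: bij_betw_def)
  ultimately show ?thesis
    unfolding has_mono_copy_def using edge by (intro exI[of _ ?S]) auto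
qed

section \<open>The upper bound\<close>

lemma proper_vertex_coloring_chromatic_number:
  assumes "simple_graph H"
  shows "\<exists>f. proper_vertex_coloring H (chromatic_number H) f"
proof -
  have fin: "finite (verts H)" using assms by (simp add: simple_graph_def)
  obtain h where h: "bij_betw h (verts H) {0..<card (verts H)}"
    using ex_bij_betw_finite_nat[OF fin] by blast
  have "h x \<noteq> h y" if "{x, y} \<in> edges H" for x y
    using simple_graph_edgeD[OF assms that] h by (auto simp: bij_betw_def inj_on_def)
  then have "proper_vertex_coloring H (card (verts H)) h"
    using h by (auto simp: proper_vertex_coloring_def bij_betw_def)
  then have "\<exists>k f. proper_vertex_coloring H k f" by blast
  then show ?thesis unfolding chromatic_number_def by (rule LeastI_ex)
qed

lemma edges_nonempty_if_chromatic_number: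
  assumes "chromatic_number H > 1"
  shows "edges H \<noteq> {}"
proof
  assume "edges H = {}"
  then have "proper_vertex_coloring H 1 (\<lambda>_. 0)" by (auto simp: proper_vertex_coloring_def)
  then have "chromatic_number H \<le> 1" unfolding chromatic_number_def by (intro Least_le) blast
  then show False using assms by simp
qed

lemma sum_incident_colors_le:
  assumes "mean_coloring 2 G c" "verts G \<noteq> {}" "finite (verts G)"
  shows "(\<Sum>v\<in>verts G. real (card (incident_colors G c v))) \<le> 2 * real (card (verts G))"
proof -
  have "real (card (verts G)) > 0" using assms(2,3) by (simp add: card_gt_0_iff)
  then show ?thesis using assms(1) by (simp add: mean_coloring_def field_simps)
qed

text \<open>The sample size \<open>m\<close> is chosen with $1/m \le \eta$; the excess $2\eta$ of $2e/n^2$ over $\frac45$ then leaves $\eta$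
for the monochromatic triangles.\<close>

lemma dense_two_mean_coloring_has_mono_copy:
  fixes H :: "'a ugraph"
  assumes H: "simple_graph H" "proper_vertex_coloring H 3 f" and "\<eta> > 0"
  shows "\<exists>n0. \<forall>(G :: 'v ugraph) (c :: 'v set \<Rightarrow> 'c).
    simple_graph G \<and> n0 \<le> card (verts G) \<and> mean_coloring 2 G c \<and>
    (2 / 5 + \<eta>) * real (card (verts G)) ^ 2 < real (card (edges G))
    \<longrightarrow> has_mono_copy G c H"
proof -
  define m where "m = Suc (nat \<lceil>1 / \<eta>\<rceil>)"
  have m: "m > 0" "1 / real m \<le> \<eta>"
  proof -
    have "1 / \<eta> \<le> real m" unfolding m_def by linarith
    moreover have "real m > 0" by (simp add: m_def)
    ultimately show "1 / real m \<le> \<eta>" using assms(3) by (simp add: field_simps)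
  qed (simp add: m_def)
  define \<delta> where "\<delta> = \<eta> / real m ^ 3"
  have \<delta>: "\<delta> > 0" using assms(3) m by (simp add: \<delta>_def)
  obtain n1 where n1: "\<forall>(V :: 'v set) T. finite V \<and> n1 \<le> card V \<and> T \<subseteq> V \<times> V \<times> V \<and>
      (\<delta> / 2)\<^sup>2 * real (card V) ^ 3 \<le> real (card T)
    \<longrightarrow> (\<exists>A B C. A \<subseteq> V \<and> B \<subseteq> V \<and> C \<subseteq> V \<and> card A = card (verts H) \<and> card B = card (verts H) \<and>
        card C = card (verts H) \<and> A \<times> B \<times> C \<subseteq> T)"
    using dense_ternary_relation_contains_box[of "(\<delta> / 2)\<^sup>2", where t = "card (verts H)" and 'v = 'v] \<delta>
    by auto
  have "has_mono_copy G c H"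
    if G: "simple_graph G" "Suc n1 \<le> card (verts G)" "mean_coloring 2 G c"
      and dense: "(2 / 5 + \<eta>) * real (card (verts G)) ^ 2 < real (card (edges G))"
    for G :: "'v ugraph" and c :: "'v set \<Rightarrow> 'c"
  proof -
    let ?V = "verts G" and ?K = "graph_colouring G c"
    define N where "N = real (card ?V)"
    have fin: "finite ?V" using G(1) by (simp add: simple_graph_def)
    have ne: "?V \<noteq> {}" using G(2) by auto
    have N: "N > 0" using fin ne by (simp add: N_def card_gt_0_iff)
    have K: "edge_colouring ?K" by (rule edge_colouring_graph_colouring[OF G(1)])
    have few: "(\<Sum>v\<in>?V. real (card (palette ?K ?V v))) \<le> 2 * real (card ?V)"
      using sum_incident_colors_le[OF G(3) ne fin] by (simp add: palette_graph_colouring[OF G(1)])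
    define t where "t = real (card (mono_triangles ?K ?V)) / N ^ 3"
    have "2 * (2 / 5 + \<eta>) < 2 * real (card (edges G)) / N ^ 2"
      using dense N by (simp add: N_def field_simps)
    also have "\<dots> \<le> 4 / 5 + 1 / real m + real m ^ 3 * t"
      using mono_triangle_supersaturation[OF fin ne K m(1) few]
      unfolding card_coloured_pairs[OF G(1)] by (simp add: N_def t_def)
    finally have "\<eta> < real m ^ 3 * t" using m(2) by (simp add: algebra_simps)
    then have "\<delta> \<le> t" using m(1) by (simp add: \<delta>_def field_simps)
    then have "\<delta> * real (card ?V) ^ 3 \<le> real (card (mono_triangles ?K ?V))"
      using N by (simp add: t_def N_def field_simps)
    then obtain a where a: "(\<delta> / 2)\<^sup>2 * real (card ?V) ^ 3 \<le>
        real (card {(x, y, z). x \<in> ?V \<and> y \<in> ?V \<and> z \<in> ?V \<and> mono_triangle ?K a x y z})"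
      using dominant_colour[OF fin K ne \<delta> few] by blast
    define T where "T = {(x, y, z). x \<in> ?V \<and> y \<in> ?V \<and> z \<in> ?V \<and> mono_triangle ?K a x y z}"
    have "T \<subseteq> ?V \<times> ?V \<times> ?V" by (auto simp: T_def)
    then obtain A B C where ABC: "A \<subseteq> ?V" "B \<subseteq> ?V" "C \<subseteq> ?V" "card A = card (verts H)"
        "card B = card (verts H)" "card C = card (verts H)" "A \<times> B \<times> C \<subseteq> T"
      using n1[rule_format, of ?V T] fin G(2) a by (auto simp: T_def)
    show ?thesis
    proof (rule has_mono_copy_if_mono_box[OF H G(1) ABC(1-6)])
      show "mono_triangle ?K a x y z" if "x \<in> A" "y \<in> B" "z \<in> C" for x y z
        using ABC(7) that by (auto simp: T_def)
    qed
  qed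
  then show ?thesis by blast
qed

lemma RT_mean_upper:
  fixes H :: "'a ugraph"
  assumes "simple_graph H" "chromatic_number H = 3" "\<eta> > 0"
  shows "\<forall>\<^sub>F n in sequentially. real (RT_mean n H 2) \<le> (2 / 5 + \<eta>) * (real n)\<^sup>2"
proof -
  obtain f where f: "proper_vertex_coloring H 3 f"
    using proper_vertex_coloring_chromatic_number[OF assms(1)] assms(2) by auto
  obtain n0 where n0: "\<forall>(G :: nat ugraph) (c :: nat set \<Rightarrow> nat).
    simple_graph G \<and> n0 \<le> card (verts G) \<and> mean_coloring 2 G c \<and>
    (2 / 5 + \<eta>) * real (card (verts G)) ^ 2 < real (card (edges G))
    \<longrightarrow> has_mono_copy G c H"
    using dense_two_mean_coloring_has_mono_copy[OF assms(1) f assms(3)] by blast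
  have "real (RT_mean n H 2) \<le> (2 / 5 + \<eta>) * (real n)\<^sup>2" if "n \<ge> n0" for n
  proof -
    have "RT_mean n H 2 \<in> RT_sizes n H 2"
      unfolding RT_mean_def
      by (rule Max_in[OF finite_RT_sizes RT_sizes_nonempty])
        (use edges_nonempty_if_chromatic_number[of H] assms(2) in auto)
    then obtain G :: "nat ugraph" and c :: "nat set \<Rightarrow> nat" where
      "RT_mean n H 2 = card (edges G)" "simple_graph G" "card (verts G) = n"
      "mean_coloring 2 G c" "\<not> has_mono_copy G c H"
      unfolding RT_sizes_def by auto
    then show ?thesis using n0 that by (metis not_le)
  qed
  then show ?thesis by (auto simp: eventually_sequentially)
qed

section \<open>The lower bound: a blow-up of the two-coloured $K_5$\<close>

definition pentagon_graph :: "nat \<Rightarrow> nat ugraph" where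
  "pentagon_graph n = ({..<n}, {{u, v} | u v. u < n \<and> v < n \<and> u mod 5 \<noteq> v mod 5})"

text \<open>Residues at distance one on the $5$-cycle give colour $1$, those at distance two give colour $0$.\<close>

definition pentagon_coloring :: "nat set \<Rightarrow> nat" where
  "pentagon_coloring e = of_bool (\<exists>u v. e = {u, v} \<and> Suc u mod 5 = v mod 5)"

lemma simple_pentagon_graph: "simple_graph (pentagon_graph n)"
proof -
  have "card {u, v} = 2" if "u mod 5 \<noteq> v mod 5" for u v :: nat
    using that by (auto simp: card_2_iff)
  then show ?thesis by (auto simp: simple_graph_def pentagon_graph_def)
qed

lemma pentagon_graph_edge_iff:
  "{u, v} \<in> edges (pentagon_graph n) \<longleftrightarrow> u < n \<and> v < n \<and> u mod 5 \<noteq> v mod 5"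
  by (auto simp: pentagon_graph_def doubleton_eq_iff)

lemma mean_coloring_pentagon: "mean_coloring 2 (pentagon_graph n) pentagon_coloring"
proof -
  have "incident_colors (pentagon_graph n) pentagon_coloring v \<subseteq> {0, 1}" for v
    by (auto simp: incident_colors_def pentagon_coloring_def)
  then have "card (incident_colors (pentagon_graph n) pentagon_coloring v) \<le> card {0, 1 :: nat}" for v
    by (intro card_mono) auto
  then have "(\<Sum>v\<in>verts (pentagon_graph n). real (card (incident_colors (pentagon_graph n) pentagon_coloring v)))
      \<le> (\<Sum>v\<in>verts (pentagon_graph n). 2)"
    by (intro sum_mono) (simp add: numeral_2_eq_2)
  then show ?thesis
    by (simp add: mean_coloring_def divide_le_eq)
qed

lemma pentagon_coloring_doubleton:
  "pentagon_coloring {u, v} = of_bool (Suc u mod 5 = v mod 5 \<or> Suc v mod 5 = u mod 5)"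
  by (auto simp: pentagon_coloring_def doubleton_eq_iff)

lemma pentagon_coloring_no_mono_triangle:
  assumes "x mod 5 \<noteq> y mod 5" "y mod 5 \<noteq> z mod 5" "x mod 5 \<noteq> z mod 5"
    and "pentagon_coloring {x, y} = k" "pentagon_coloring {y, z} = k" "pentagon_coloring {x, z} = k"
  shows False
proof -
  have residue: "u mod 5 \<in> {0, 1, 2, 3, 4}" for u :: nat by auto
  have adj: "pentagon_coloring {u, v} =
      of_bool (Suc (u mod 5) mod 5 = v mod 5 \<or> Suc (v mod 5) mod 5 = u mod 5)" for u v
    by (simp only: pentagon_coloring_doubleton mod_Suc_eq)
  show False
    using residue[of x] residue[of y] residue[of z] assms unfolding adj
    by (elim insertE emptyE) simp_all
qed

lemma no_mono_copy_pentagon: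
  assumes "contains_triangle H"
  shows "\<not> has_mono_copy (pentagon_graph n) pentagon_coloring H"
proof
  assume "has_mono_copy (pentagon_graph n) pentagon_coloring H"
  then obtain S k where "subgraph S (pentagon_graph n)" and iso: "isomorphic H S"
    and k: "\<forall>e\<in>edges S. pentagon_coloring e = k"
    unfolding has_mono_copy_def by blast
  moreover obtain f where "edges S = (`) f ` edges H"
    using iso unfolding isomorphic_def by blast
  ultimately have S: "edges S \<subseteq> edges (pentagon_graph n)" "edges S = (`) f ` edges H"
    unfolding subgraph_def by blast+
  obtain x y z where xyz: "{x, y} \<in> edges H" "{y, z} \<in> edges H" "{x, z} \<in> edges H"
    using assms by (auto simp: contains_triangle_def)
  have edge: "f u mod 5 \<noteq> f v mod 5 \<and> pentagon_coloring {f u, f v} = k" if "{u, v} \<in> edges H" for u v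
  proof -
    have "f ` {u, v} \<in> edges S" unfolding S(2) using that by (rule imageI)
    then have "{f u, f v} \<in> edges S" by simp
    then show ?thesis using S(1) k pentagon_graph_edge_iff by blast
  qed
  show False
    using pentagon_coloring_no_mono_triangle edge[OF xyz(1)] edge[OF xyz(2)] edge[OF xyz(3)] by blast
qed

lemma card_residue_class_le: "real (card {v. v < n \<and> v mod 5 = (r :: nat)}) \<le> real n / 5 + 1"
proof -
  have "card {v. v < n \<and> v mod 5 = r} \<le> card {..n div 5}"
  proof (rule card_inj_on_le)
    show "inj_on (\<lambda>v. v div 5) {v. v < n \<and> v mod 5 = r}"
      by (rule inj_onI) (metis (mono_tags, lifting) div_mult_mod_eq mem_Collect_eq)
  qed (auto intro: div_le_mono)
  then have "card {v. v < n \<and> v mod 5 = r} \<le> n div 5 + 1" by simp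
  moreover have "5 * (n div 5) \<le> n" by simp
  ultimately show ?thesis by linarith
qed

text \<open>Each vertex has at least $n - (n/5 + 1)$ neighbours; the rounding costs only a linear term.\<close>

lemma card_edges_pentagon_ge: "2 / 5 * (real n)\<^sup>2 - real n / 2 \<le> real (card (edges (pentagon_graph n)))"
proof -
  have "real n * (4 / 5 * real n - 1) = (\<Sum>u<n. 4 / 5 * real n - 1)" by simp
  also have "\<dots> \<le> (\<Sum>u<n. real (card {v. v < n \<and> u mod 5 \<noteq> v mod 5}))"
  proof (rule sum_mono)
    fix u
    have split: "{..<n} = {v. v < n \<and> u mod 5 \<noteq> v mod 5} \<union> {v. v < n \<and> v mod 5 = u mod 5}" by auto
    have "card {..<n} \<le> card {v. v < n \<and> u mod 5 \<noteq> v mod 5} + card {v. v < n \<and> v mod 5 = u mod 5}"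
      by (subst split, rule card_Un_le)
    then show "4 / 5 * real n - 1 \<le> real (card {v. v < n \<and> u mod 5 \<noteq> v mod 5})"
      using card_residue_class_le[of n "u mod 5"] by simp
  qed
  also have "\<dots> = real (card (SIGMA u:{..<n}. {v. v < n \<and> u mod 5 \<noteq> v mod 5}))"
    by (subst card_SigmaI) auto
  also have "(SIGMA u:{..<n}. {v. v < n \<and> u mod 5 \<noteq> v mod 5}) = {(u, v). {u, v} \<in> edges (pentagon_graph n)}"
    by (auto simp: pentagon_graph_edge_iff)
  also have "real (card \<dots>) = 2 * real (card (edges (pentagon_graph n)))"
    by (simp add: card_adjacent_pairs[OF simple_pentagon_graph])
  finally show ?thesis by (simp add: power2_eq_square algebra_simps)
qed

lemma RT_mean_lower:
  assumes "contains_triangle H"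
  shows "2 / 5 * (real n)\<^sup>2 - real n / 2 \<le> real (RT_mean n H 2)"
proof -
  have "card (edges (pentagon_graph n)) \<in> RT_sizes n H 2"
    unfolding RT_sizes_def mem_Collect_eq
  proof (intro exI[of _ "pentagon_graph n"] exI[of _ pentagon_coloring] conjI)
    show "card (verts (pentagon_graph n)) = n" by (simp add: pentagon_graph_def)
  qed (simp_all add: simple_pentagon_graph mean_coloring_pentagon no_mono_copy_pentagon[OF assms])
  then have "card (edges (pentagon_graph n)) \<le> RT_mean n H 2"
    unfolding RT_mean_def by (intro Max_ge finite_RT_sizes)
  then show ?thesis using card_edges_pentagon_ge[of n] by linarith
qed

section \<open>The asymptotic value\<close>

text \<open>The error term is the relative deviation from $0.4\,n^2$; its positive part serves for the upper bound, where
nothing is known from below.\<close>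

theorem corollary1p5:
  fixes H :: "'a ugraph"
  assumes "simple_graph H" and "chromatic_number H = 3"
  shows "(\<exists>\<epsilon> :: nat \<Rightarrow> real. \<epsilon> \<in> o(\<lambda>_. 1) \<and>
            (\<forall>\<^sub>F n in sequentially. real (RT_mean n H 2) \<le> 0.4 * (real n)\<^sup>2 * (1 + \<epsilon> n)))
       \<and> (contains_triangle H \<longrightarrow>
           (\<exists>\<epsilon> :: nat \<Rightarrow> real. \<epsilon> \<in> o(\<lambda>_. 1) \<and>
            (\<forall>\<^sub>F n in sequentially. real (RT_mean n H 2) = 0.4 * (real n)\<^sup>2 * (1 + \<epsilon> n))))"
proof -
  define err where "err n = real (RT_mean n H 2) / (0.4 * (real n)\<^sup>2) - 1" for n
  have err_eq: "real (RT_mean n H 2) = 0.4 * (real n)\<^sup>2 * (1 + err n)" if "n > 0" for n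
  proof -
    have "0.4 * (real n)\<^sup>2 \<noteq> 0" using that by simp
    then show ?thesis by (simp only: err_def) simp
  qed
  have err_upper: "\<forall>\<^sub>F n in sequentially. err n \<le> d" if "d > 0" for d
  proof -
    have "\<forall>\<^sub>F n in sequentially. real (RT_mean n H 2) \<le> (2 / 5 + 2 / 5 * d) * (real n)\<^sup>2"
      by (rule RT_mean_upper) (use assms that in auto)
    then show ?thesis
      using eventually_gt_at_top[of 0]
    proof eventually_elim
      case (elim n)
      then show ?case by (simp add: err_def field_simps)
    qed
  qed
  have small: "f \<in> o(\<lambda>_. 1)" if "\<And>d. d > 0 \<Longrightarrow> \<forall>\<^sub>F n in sequentially. \<bar>f n\<bar> \<le> d" for f :: "nat \<Rightarrow> real"
    by (rule landau_o.smallI) (use that in simp)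
  have "(\<lambda>n. max 0 (err n)) \<in> o(\<lambda>_. 1)"
    by (rule small) (use err_upper in \<open>force elim: eventually_mono\<close>)
  moreover have "\<forall>\<^sub>F n in sequentially. real (RT_mean n H 2) \<le> 0.4 * (real n)\<^sup>2 * (1 + max 0 (err n))"
    using eventually_gt_at_top[of 0]
  proof eventually_elim
    case (elim n)
    show ?case unfolding err_eq[OF elim] by (intro mult_left_mono) auto
  qed
  moreover have "err \<in> o(\<lambda>_. 1) \<and> (\<forall>\<^sub>F n in sequentially. real (RT_mean n H 2) = 0.4 * (real n)\<^sup>2 * (1 + err n))"
    if triangle: "contains_triangle H"
  proof
    show "err \<in> o(\<lambda>_. 1)"
    proof (rule small)
      fix d :: real assume d: "d > 0"
      have "\<forall>\<^sub>F n in sequentially. real n > 5 / (4 * d)"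
        by (rule filterlim_real_sequentially[THEN filterlim_at_top_dense[THEN iffD1], rule_format])
      then show "\<forall>\<^sub>F n in sequentially. \<bar>err n\<bar> \<le> d"
        using err_upper[OF d] eventually_gt_at_top[of 0]
      proof eventually_elim
        case (elim n)
        have "5 / 4 \<le> d * real n" using elim(1) d by (simp add: field_simps)
        then have "real n / 2 \<le> 2 / 5 * d * (real n)\<^sup>2"
          using mult_right_mono[of "5 / 4" "d * real n" "real n"] by (simp add: power2_eq_square)
        then have "(1 - d) * (0.4 * (real n)\<^sup>2) \<le> real (RT_mean n H 2)"
          using RT_mean_lower[OF triangle, of n] by (simp add: algebra_simps)
        then have "1 - d \<le> real (RT_mean n H 2) / (0.4 * (real n)\<^sup>2)"
          using elim(3) by (simp add: pos_le_divide_eq)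
        then show ?case using elim(2) by (simp add: err_def)
      qed
    qed
    show "\<forall>\<^sub>F n in sequentially. real (RT_mean n H 2) = 0.4 * (real n)\<^sup>2 * (1 + err n)"
      using eventually_gt_at_top[of 0] by eventually_elim (rule err_eq)
  qed
  ultimately show ?thesis by blast
qed

end
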